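(* There is an algorithm which, given any one-dimensional Peg Solitaire configuration $w\in\{0,1\}^n$, computes in time $O(n)$ a sequence of hops transforming $w$ into a configuration whose number of pegs is the minimum number of pegs among all configurations reachable from $w$ by sequences of hops.
   Context: One-dimensional Peg Solitaire: a configuration is a finite word $w=c_0\cdots c_{n-1}\in\{0,1\}^*$ describing a row of $n$ consecutive sites ($1$ = peg, $0$ = hole); the board consists exactly of these sites. A hop takes three consecutive sites within the board with pegs on one end site and the middle site and a hole on the other end site, moves the end peg into the hole and removes the middle peg ($110\to001$ or $011\to100$). The computational model is the standard RAM model. *)

theory Defs
  imports Main
begin

text \<open>A configuration is a word over {0,1}, represented as a bool list
  (True = peg, False = hole). A hop is given by a position i (the leftmost
  of the three consecutive sites i, i+1, i+2) and a direction d: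
  d = False means 110 -> 001 (peg at i jumps right over i+1 into i+2),
  d = True  means 011 -> 100 (peg at i+2 jumps left over i+1 into i).\<close>

definition hop_at :: "nat \<Rightarrow> bool \<Rightarrow> bool list \<Rightarrow> bool list \<Rightarrow> bool" where
  "hop_at i d w w' \<longleftrightarrow> i + 2 < length w \<and>
     (if \<not> d then w ! i \<and> w ! (i+1) \<and> \<not> w ! (i+2) \<and>
                  w' = w[i := False, i+1 := False, i+2 := True]
      else \<not> w ! i \<and> w ! (i+1) \<and> w ! (i+2) \<and>
                  w' = w[i := True, i+1 := False, i+2 := False])"

definition hop :: "bool list \<Rightarrow> bool list \<Rightarrow> bool" where
  "hop w w' \<longleftrightarrow> (\<exists>i d. hop_at i d w w')"

definition reachable :: "bool list \<Rightarrow> bool list \<Rightarrow> bool" where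
  "reachable = hop\<^sup>*\<^sup>*"

definition pegs :: "bool list \<Rightarrow> nat" where
  "pegs w = length (filter id w)"

fun hop_seq :: "(nat \<times> bool) list \<Rightarrow> bool list \<Rightarrow> bool list \<Rightarrow> bool" where
  "hop_seq [] w w' \<longleftrightarrow> w' = w"
| "hop_seq (h # hs) w w' \<longleftrightarrow> (\<exists>v. hop_at (fst h) (snd h) w v \<and> hop_seq hs v w')"

text \<open>Memory: registers indexed by integers, holding integers. Instructions
  operate with direct and indirect addressing; each instruction costs one
  time unit. The program counter indexes the instruction list; a program
  halts when it executes Halt or the pc leaves the program.\<close>

datatype instr =
    Const int int
  | Add int int int
  | Sub int int int
  | Load int int
  | Store int int
  | Jz int nat
  | Jpos int nat
  | Jmp nat
  | Halt

type_synonym config = "nat \<times> (int \<Rightarrow> int)"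

definition fetch :: "instr list \<Rightarrow> nat \<Rightarrow> instr" where
  "fetch P pc = (if pc < length P then P ! pc else Halt)"

fun exec :: "instr \<Rightarrow> config \<Rightarrow> config" where
  "exec (Const r c) (pc, m) = (pc + 1, m(r := c))"
| "exec (Add r a b) (pc, m) = (pc + 1, m(r := m a + m b))"
| "exec (Sub r a b) (pc, m) = (pc + 1, m(r := m a - m b))"
| "exec (Load r a) (pc, m) = (pc + 1, m(r := m (m a)))"
| "exec (Store a r) (pc, m) = (pc + 1, m(m a := m r))"
| "exec (Jz r l) (pc, m) = (if m r = 0 then l else pc + 1, m)"
| "exec (Jpos r l) (pc, m) = (if m r > 0 then l else pc + 1, m)"
| "exec (Jmp l) (pc, m) = (l, m)"
| "exec Halt (pc, m) = (pc, m)"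

definition step :: "instr list \<Rightarrow> config \<Rightarrow> config" where
  "step P s = exec (fetch P (fst s)) s"

definition halted :: "instr list \<Rightarrow> config \<Rightarrow> bool" where
  "halted P s \<longleftrightarrow> fetch P (fst s) = Halt"

definition init_mem :: "bool list \<Rightarrow> int \<Rightarrow> int" where
  "init_mem w a = (if a = 0 then int (length w)
     else if 1 \<le> a \<and> a \<le> int (length w) then (if w ! (nat a - 1) then 1 else 0)
     else 0)"

definition output_hops :: "(int \<Rightarrow> int) \<Rightarrow> (nat \<times> bool) list \<Rightarrow> bool" where
  "output_hops m hs \<longleftrightarrow> m 0 = int (length hs) \<and>
     (\<forall>j < length hs. m (int j + 1) = 2 * int (fst (hs ! j)) + (if snd (hs ! j) then 1 else 0))"

end

theory Submission
  imports Defs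
begin

text \<open>On a board that is not completely filled, the minimum number of pegs is the least number of pieces
  in a decomposition of the word into holes and pieces, a piece being a word that can be reduced to one
  peg on an unbounded board. Pieces form a regular language, so this number is the cheapest cost of a
  walk in a finite automaton with costs 0 and 1. Three facts about the automaton suffice: undoing a hop
  never increases the cost, since every walk along 001 can be replaced by one along 110 with the same
  end states and the same cost, and likewise for 100 and 011; the cost is at most the number of pegs;
  and as long as it is smaller and the board has a hole, some hop does not increase it.

  Hence it is optimal to perform cost-preserving hops greedily. A hop that is not cost-preserving
  remains so after any cost-preserving hop on disjoint sites. A cursor that moves right, and goes back by
  two sites after every hop, therefore finds all of them. The cost after a candidate hop is computed in
  constant time from the cheapest costs of the prefix and of the suffix, which are stored for every
  position and updated as the cursor moves. Since every hop removes a peg, the number of cursor moves is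
  linear.\<close>

section \<open>The piece automaton\<close>

text \<open>Most edges back to an earlier state record hops made inside the part already read:
  \<open>110\<close> becomes \<open>001\<close>, \<open>1011\<close> becomes \<open>0010\<close>,
  \<open>11110\<close> becomes \<open>00101\<close>, \<open>111011\<close> becomes
  \<open>001010\<close>, \<open>1111110\<close> becomes \<open>0010101\<close>, and state 0 skips
  the holes in front. The other merges, \<open>101010\<close> with \<open>1010\<close>,
  \<open>111110\<close> with \<open>1110\<close> and \<open>1111111\<close> with
  \<open>11111\<close>, make the periodic parts of long pieces finite. The obstacle is the finite
  board. A piece longer than \<open>11\<close> contains a window whose hop the automaton can follow,
  but \<open>11\<close> itself needs a hole beside it, and that hole may lie beyond a long run of
  pegs. Splitting the run into other pieces brings the hop next to the hole without raising the
  cost, since a run of \<open>m\<close> pegs costs at most half of \<open>m\<close>, rounded up.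
  Only the completely filled board offers no hole, and there no hop exists at all.\<close>

text \<open>State 0 lies between two pieces. The states 1 to 12 are reached by reading the beginnings 1, 10,
  11, 101, 111, 1010, 1110, 1111, 10101, 11101, 11111, 111111 of a piece, and the last letter of a piece
  leads back to 0. In \<open>(p, q, k)\<close> the number \<open>k\<close> is the cost, which is paid at the first peg of a
  piece.\<close>
fun edges :: "bool \<Rightarrow> (nat \<times> nat \<times> nat) list" where
  "edges False = [(0,0,0),(1,2,0),(4,6,0),(9,6,0),(3,1,0),(5,7,0),(11,7,0),(8,4,0),(12,9,0)]"
| "edges True = [(0,1,1),(0,0,1),(1,3,0),(1,0,0),(2,4,0),(3,5,0),(4,2,0),(4,0,0),(5,8,0),
     (6,9,0),(7,10,0),(8,11,0),(12,11,0),(10,6,0),(11,12,0),(9,0,0)]"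

inductive walk :: "nat \<Rightarrow> bool list \<Rightarrow> nat \<Rightarrow> nat \<Rightarrow> bool" where
  Nil: "walk p [] p 0"
| Cons: "(p, q, k) \<in> set (edges b) \<Longrightarrow> walk q w r c \<Longrightarrow> walk p (b # w) r (k + c)"

lemma walk_Nil_iff [simp]: "walk p [] q c \<longleftrightarrow> q = p \<and> c = 0"
  by (auto intro: walk.intros elim: walk.cases)

lemma walk_Cons_iff:
  "walk p (b # w) r c \<longleftrightarrow> (\<exists>q k c'. (p, q, k) \<in> set (edges b) \<and> walk q w r c' \<and> c = k + c')"
  by (auto intro: walk.intros elim!: walk.cases[of p "b # w"])

lemma walk_append_iff:
  "walk p (u @ v) r c \<longleftrightarrow> (\<exists>q c1 c2. walk p u q c1 \<and> walk q v r c2 \<and> c = c1 + c2)"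
proof (induction u arbitrary: p c)
  case (Cons b u)
  show ?case
  proof
    assume "walk p ((b # u) @ v) r c"
    then obtain q k c' where 1: "(p, q, k) \<in> set (edges b)" "walk q (u @ v) r c'" "c = k + c'"
      by (auto simp: walk_Cons_iff)
    then obtain q' c1 c2 where "walk q u q' c1" "walk q' v r c2" "c' = c1 + c2"
      using Cons.IH by blast
    with 1 show "\<exists>q c1 c2. walk p (b # u) q c1 \<and> walk q v r c2 \<and> c = c1 + c2"
      by (metis add.assoc walk.Cons)
  next
    assume "\<exists>q c1 c2. walk p (b # u) q c1 \<and> walk q v r c2 \<and> c = c1 + c2"
    then show "walk p ((b # u) @ v) r c"
      using Cons.IH by (force simp: walk_Cons_iff)
  qed
qed simp

lemma walk_snoc_iff:
  "walk p (u @ [b]) r c \<longleftrightarrow> (\<exists>q k c'. walk p u q c' \<and> (q, r, k) \<in> set (edges b) \<and> c = k + c')"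
  unfolding walk_append_iff walk_Cons_iff by (auto; metis add.commute)

definition cost_le :: "bool list \<Rightarrow> nat \<Rightarrow> bool" where
  "cost_le w c \<longleftrightarrow> (\<exists>c' \<le> c. walk 0 w 0 c')"

text \<open>An executable table of all walks along a fixed nonempty word, so that inclusions between
  the walks along short words can be decided by evaluation.\<close>

fun walks :: "bool list \<Rightarrow> (nat \<times> nat \<times> nat) list" where
  "walks [] = []"
| "walks [b] = edges b"
| "walks (b # w) = [(p, r, k + c). (p, q, k) \<leftarrow> edges b, (q', r, c) \<leftarrow> walks w, q' = q]"

lemma walk_iff_walks: "w \<noteq> [] \<Longrightarrow> walk p w q c \<longleftrightarrow> (p, q, c) \<in> set (walks w)"
proof (induction w arbitrary: p c)
  case (Cons b w)
  note IH = Cons.IH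
  show ?case
  proof (cases w)
    case Nil
    then show ?thesis by (simp add: walk_Cons_iff)
  next
    case (Cons b' w')
    have "walk p (b # w) q c \<longleftrightarrow>
      (\<exists>q' k c'. (p, q', k) \<in> set (edges b) \<and> (q', q, c') \<in> set (walks w) \<and> c = k + c')"
      unfolding walk_Cons_iff[of p b] using IH Cons by simp
    also have "\<dots> \<longleftrightarrow> (p, q, c) \<in> set (walks (b # w))"
      unfolding Cons walks.simps(3) set_concat set_map by (auto simp del: walks.simps; blast)
    finally show ?thesis .
  qed
qed simp

text \<open>Finitely many triples are compared by evaluation. Keeping both end states and the exact
  cost is what makes the replacement possible in every context.\<close>

lemma walk_unhop:
  assumes "walk p [b, False, \<not> b] q c"
  shows "walk p [\<not> b, True, b] q c"
proof -
  \<comment> \<open>\<open>code_simp\<close> needs a closed goal, hence the quantifier over both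
    letters.\<close>
  have *: "\<forall>b \<in> {True, False}. set (walks [b, False, \<not> b]) \<subseteq> set (walks [\<not> b, True, b])"
    by code_simp
  have "set (walks [b, False, \<not> b]) \<subseteq> set (walks [\<not> b, True, b])"
    by (rule bspec[OF *]) simp
  then show ?thesis using assms unfolding walk_iff_walks[OF list.distinct(2)] by (rule subsetD)
qed

lemma list_window: "i + 2 < length w \<Longrightarrow> w = take i w @ [w ! i, w ! (i+1), w ! (i+2)] @ drop (i+3) w"
  by (simp add: Cons_nth_drop_Suc numeral_3_eq_3 numeral_2_eq_2)

text \<open>Since \<open>d\<close> is also the last letter of the window, both kinds of hop take the
  single form \<open>(\<not> d) 1 d\<close> to \<open>d 0 (\<not> d)\<close>, and later proofs treat
  them together.\<close>

lemma hop_at_iff: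
  "hop_at i d w v \<longleftrightarrow>
    (\<exists>u z. w = u @ [\<not> d, True, d] @ z \<and> v = u @ [d, False, \<not> d] @ z \<and> length u = i)"
  (is "?l \<longleftrightarrow> ?r")
proof
  assume l: ?l
  then have i: "i + 2 < length w" and x: "w ! i = (\<not> d)" "w ! (i+1)" "w ! (i+2) = d"
    and v: "v = w[i := d, i+1 := False, i+2 := \<not> d]"
    by (auto simp: hop_at_def split: if_splits)
  define u z where "u = take i w" and "z = drop (i+3) w"
  have w: "w = u @ [\<not> d, True, d] @ z"
    using list_window[OF i] x by (simp add: u_def z_def)
  have u: "length u = i" using i by (simp add: u_def)
  have "v = u @ [d, False, \<not> d] @ z"
    unfolding v w using u by (auto simp: list_update_append nth_append)
  with w u show ?r by blast
next
  assume ?r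
  then show ?l
    by (auto simp: hop_at_def list_update_append nth_append)
qed

lemma walk_unhop_context:
  assumes "walk p (u @ [d, False, \<not> d] @ z) q c"
  shows "walk p (u @ [\<not> d, True, d] @ z) q c"
  using assms walk_unhop unfolding walk_append_iff[of p u] walk_append_iff[of _ "[_, _, _]"] by blast

text \<open>Read forwards, a hop never lowers the cost, so the initial cost bounds the cost of every
  reachable word from below.\<close>

lemma cost_le_unhop: "hop_at i d w v \<Longrightarrow> cost_le v c \<Longrightarrow> cost_le w c"
  unfolding hop_at_iff cost_le_def using walk_unhop_context by blast

lemma pegs_simps [simp]: "pegs [] = 0" "pegs (b # w) = (if b then 1 else 0) + pegs w"
  "pegs (u @ v) = pegs u + pegs v"
  by (auto simp: pegs_def)

lemma pegs_hop: "hop_at i d w v \<Longrightarrow> pegs w = Suc (pegs v)"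
  by (auto simp: hop_at_iff)

lemma pegs_le_length: "pegs w \<le> length w"
  by (simp add: pegs_def)

text \<open>Every peg is taken as a piece of its own.\<close>

lemma walk_singles: "walk 0 w 0 (pegs w)"
proof (induction w)
  case (Cons b w)
  have "(0, 0, if b then 1 else 0) \<in> set (edges b)" by simp
  from walk.Cons[OF this Cons.IH] show ?case by simp
qed simp

section \<open>Existence of a cost-preserving hop\<close>

definition hoppable :: "nat \<Rightarrow> bool list \<Rightarrow> nat \<Rightarrow> bool" where
  "hoppable p w c \<longleftrightarrow> (\<exists>i d v c'. hop_at i d w v \<and> walk p v 0 c' \<and> c' \<le> c)"

lemma hoppable_here:
  assumes "walk p [d, False, \<not> d] q k" "walk q z 0 c" "k + c \<le> c'"
  shows "hoppable p ((\<not> d) # True # d # z) c'"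
proof -
  have "hop_at 0 d ((\<not> d) # True # d # z) (d # False # (\<not> d) # z)"
    by (auto simp: hop_at_def)
  moreover have "walk p ([d, False, \<not> d] @ z) 0 (k + c)"
    using assms walk_append_iff by blast
  ultimately show ?thesis using assms(3) unfolding hoppable_def by auto
qed

lemma hoppable_011: "walk p [True, False, False] q k \<Longrightarrow> walk q z 0 c \<Longrightarrow> k + c \<le> c' \<Longrightarrow>
    hoppable p (False # True # True # z) c'"
  using hoppable_here[of p True] by simp

lemma hoppable_110: "walk p [False, False, True] q k \<Longrightarrow> walk q z 0 c \<Longrightarrow> k + c \<le> c' \<Longrightarrow>
    hoppable p (True # True # False # z) c'"
  using hoppable_here[of p False] by simp

lemma hoppable_Cons:
  assumes "(p, q, k) \<in> set (edges b)" "hoppable q w c" "k + c \<le> c'"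
  shows "hoppable p (b # w) c'"
proof -
  from assms(2) obtain i d v c'' where "hop_at i d w v" "walk q v 0 c''" "c'' \<le> c"
    by (auto simp: hoppable_def)
  then have "hop_at (Suc i) d (b # w) (b # v)" "walk p (b # v) 0 (k + c'')" "k + c'' \<le> c'"
    using assms by (auto simp: hop_at_def intro: walk.intros)
  then show ?thesis unfolding hoppable_def by blast
qed


lemma hoppable_mono: "hoppable p w c \<Longrightarrow> c \<le> c' \<Longrightarrow> hoppable p w c'"
  unfolding hoppable_def using le_trans by blast

lemma hoppable_Cons0: "(p, q, 0) \<in> set (edges b) \<Longrightarrow> hoppable q w c \<Longrightarrow> hoppable p (b # w) c"
  by (rule hoppable_Cons) auto

lemma hoppable_Cons_Cons0: "(p, q, 0) \<in> set (edges b) \<Longrightarrow> (q, r, 0) \<in> set (edges b') \<Longrightarrow>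
    hoppable r w c \<Longrightarrow> hoppable p (b # b' # w) c"
  by (blast intro: hoppable_Cons0)

text \<open>The cost of the rest is a difference instead of a quantified number, so that the
  simplifier can run through the edge list.\<close>

lemma walk_Cons_eval:
  "walk p (b # w) r c \<longleftrightarrow>
    list_ex (\<lambda>(p', q, k). p' = p \<and> k \<le> c \<and> walk q w r (c - k)) (edges b)"
proof
  assume "walk p (b # w) r c"
  then obtain q k c' where "(p, q, k) \<in> set (edges b)" "walk q w r c'" "c = k + c'"
    unfolding walk_Cons_iff by blast
  then show "list_ex (\<lambda>(p', q, k). p' = p \<and> k \<le> c \<and> walk q w r (c - k)) (edges b)"
    unfolding list_ex_iff by (intro bexI[of _ "(p, q, k)"]) auto
next
  assume "list_ex (\<lambda>(p', q, k). p' = p \<and> k \<le> c \<and> walk q w r (c - k)) (edges b)"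
  then obtain q k where "(p, q, k) \<in> set (edges b)" "k \<le> c" "walk q w r (c - k)"
    by (auto simp: list_ex_iff)
  then show "walk p (b # w) r c"
    using walk.Cons[of p q k b w r "c - k"] by simp
qed

lemma walk_word_eval:
  "walk p z 0 c \<longleftrightarrow> (z = [] \<and> p = 0 \<and> c = 0) \<or>
    (\<exists>z'. z = True # z' \<and> list_ex (\<lambda>(p', q, k). p' = p \<and> k \<le> c \<and> walk q z' 0 (c - k)) (edges True)) \<or>
    (\<exists>z'. z = False # z' \<and> list_ex (\<lambda>(p', q, k). p' = p \<and> k \<le> c \<and> walk q z' 0 (c - k)) (edges False))"
proof (cases z)
  case (Cons b z')
  then show ?thesis by (cases b) (simp_all only: walk_Cons_eval list.distinct list.inject simp_thms)
qed auto

text \<open>None of these states is the final state 0, so a letter must follow; \<open>c\<close>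
  does not change because only edges out of state 0 cost anything.\<close>

lemma walk_from:
  "walk 1 z 0 c \<longleftrightarrow> (\<exists>z'. z = True # z' \<and> (walk 3 z' 0 c \<or> walk 0 z' 0 c)) \<or> (\<exists>z'. z = False # z' \<and> walk 2 z' 0 c)"
  "walk 2 z 0 c \<longleftrightarrow> (\<exists>z'. z = True # z' \<and> walk 4 z' 0 c)"
  "walk 3 z 0 c \<longleftrightarrow> (\<exists>z'. z = True # z' \<and> walk 5 z' 0 c) \<or> (\<exists>z'. z = False # z' \<and> walk 1 z' 0 c)"
  "walk 4 z 0 c \<longleftrightarrow> (\<exists>z'. z = True # z' \<and> (walk 2 z' 0 c \<or> walk 0 z' 0 c)) \<or> (\<exists>z'. z = False # z' \<and> walk 6 z' 0 c)"
  "walk 5 z 0 c \<longleftrightarrow> (\<exists>z'. z = True # z' \<and> walk 8 z' 0 c) \<or> (\<exists>z'. z = False # z' \<and> walk 7 z' 0 c)"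
  "walk 6 z 0 c \<longleftrightarrow> (\<exists>z'. z = True # z' \<and> walk 9 z' 0 c)"
  "walk 7 z 0 c \<longleftrightarrow> (\<exists>z'. z = True # z' \<and> walk 10 z' 0 c)"
  "walk 8 z 0 c \<longleftrightarrow> (\<exists>z'. z = True # z' \<and> walk 11 z' 0 c) \<or> (\<exists>z'. z = False # z' \<and> walk 4 z' 0 c)"
  "walk 9 z 0 c \<longleftrightarrow> (\<exists>z'. z = True # z' \<and> walk 0 z' 0 c) \<or> (\<exists>z'. z = False # z' \<and> walk 6 z' 0 c)"
  "walk 10 z 0 c \<longleftrightarrow> (\<exists>z'. z = True # z' \<and> walk 6 z' 0 c)"
  "walk 11 z 0 c \<longleftrightarrow> (\<exists>z'. z = True # z' \<and> walk 12 z' 0 c) \<or> (\<exists>z'. z = False # z' \<and> walk 7 z' 0 c)"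
  "walk 12 z 0 c \<longleftrightarrow> (\<exists>z'. z = True # z' \<and> walk 11 z' 0 c) \<or> (\<exists>z'. z = False # z' \<and> walk 9 z' 0 c)"
  by (subst walk_word_eval, simp)+

text \<open>From state 9 a piece goes on with copies of \<open>01\<close> and a final
  \<open>1\<close>, and the last \<open>01\<close> forms the window \<open>011\<close> with that
  \<open>1\<close>. If there is no copy, the window begins in letters already read. Here and in the
  following lemmas the extra alternatives describe such overlapping windows; they are resolved from
  an earlier state.\<close>

lemma hoppable_9:
  "walk 9 z 0 c \<Longrightarrow> (\<exists>z'. z = True # z' \<and> walk 0 z' 0 c) \<or> hoppable 9 z c"
proof (induction z rule: length_induct)
  case (1 z)
  from 1(2) consider z1 where "z = True # z1" "walk 0 z1 0 c"
    | z2 where "z = False # True # z2" "walk 9 z2 0 c"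
    by (auto simp: walk_from(9)[of z] walk_from(6))
  then show ?case
  proof cases
    case 2
    with 1(1) consider z3 where "z2 = True # z3" "walk 0 z3 0 c" | "hoppable 9 z2 c" by force
    then have "hoppable 9 z c"
    proof cases
      case 1
      then show ?thesis using 2
        by (auto simp: walk_Cons_iff intro!: hoppable_011[where q=0 and k=0 and c=c])
    next
      case h: 2
      show ?thesis unfolding 2(1) by (rule hoppable_Cons_Cons0[of 9 6 _ 9, OF _ _ h]) auto
    qed
    then show ?thesis ..
  qed blast
qed

lemma hoppable_4:
  assumes "walk 4 z 0 c"
  shows "(\<exists>z'. z = True # z' \<and> (walk 2 z' 0 c \<or> walk 0 z' 0 c)) \<or> hoppable 4 z c"
proof -
  from assms consider "\<exists>z'. z = True # z' \<and> (walk 2 z' 0 c \<or> walk 0 z' 0 c)"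
    | z2 where "z = False # True # z2" "walk 9 z2 0 c"
    by (auto simp: walk_from(4)[of z] walk_from(6))
  then show ?thesis
  proof cases
    case 2
    with hoppable_9[of z2 c] consider z3 where "z2 = True # z3" "walk 0 z3 0 c" | "hoppable 9 z2 c" by blast
    then have "hoppable 4 z c"
    proof cases
      case 1
      then show ?thesis using 2
        by (auto simp: walk_Cons_iff intro!: hoppable_011[where q=0 and k=0 and c=c])
    next
      case h: 2
      show ?thesis unfolding 2(1) by (rule hoppable_Cons_Cons0[of 4 6 _ 9, OF _ _ h]) auto
    qed
    then show ?thesis ..
  qed blast
qed

text \<open>States 11 and 12 stand for odd and even runs of pegs. A hole after an even run closes
  the window \<open>110\<close>; after an odd run the hole must be followed by two pegs, which gives
  \<open>011\<close>. The states alternate along the run, so the induction is simultaneous.\<close>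

lemma hoppable_11_12:
  "(walk 11 z 0 c \<longrightarrow> (\<exists>z'. z = True # False # z' \<and> walk 9 z' 0 c) \<or> hoppable 11 z c) \<and>
   (walk 12 z 0 c \<longrightarrow> (\<exists>z'. z = False # z' \<and> walk 9 z' 0 c) \<or> hoppable 12 z c)"
proof (induction z)
  case (Cons b z)
  have "(\<exists>z'. b # z = True # False # z' \<and> walk 9 z' 0 c) \<or> hoppable 11 (b # z) c"
    if w11: "walk 11 (b # z) 0 c"
  proof (cases b)
    case True
    then have "walk 12 z 0 c" using that by (auto simp: walk_from(11))
    with Cons.IH consider z' where "z = False # z'" "walk 9 z' 0 c" | "hoppable 12 z c" by blast
    then show ?thesis
    proof cases
      case 2
      then have "hoppable 11 (True # z) c" by (rule hoppable_Cons0[rotated]) simp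
      then show ?thesis using True by simp
    qed (use True in simp)
  next
    case False
    then obtain z' where "z = True # True # z'" "walk 6 z' 0 c"
      using w11 walk_from(11)[of "b # z" c] walk_from(7)[of z c] walk_from(10) by auto
    then show ?thesis using False
      by (auto simp: walk_Cons_iff intro!: hoppable_011[where q=6 and k=0 and c=c])
  qed
  moreover have "(\<exists>z'. b # z = False # z' \<and> walk 9 z' 0 c) \<or> hoppable 12 (b # z) c"
    if "walk 12 (b # z) 0 c"
  proof (cases b)
    case True
    then have "walk 11 z 0 c" using that by (auto simp: walk_from(12))
    with Cons.IH consider z' where "z = True # False # z'" "walk 9 z' 0 c" | "hoppable 11 z c" by blast
    then show ?thesis
    proof cases
      case 1
      then show ?thesis using True
        by (auto simp: walk_Cons_iff intro!: hoppable_110[where q=9 and k=0 and c=c])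
    next
      case 2
      then have "hoppable 12 (True # z) c" by (rule hoppable_Cons0[rotated]) simp
      then show ?thesis using True by simp
    qed
  qed (use that in \<open>auto simp: walk_from(12)\<close>)
  ultimately show ?case by blast
qed (simp add: walk_from(11,12)[of "[]"])

lemma hoppable_8:
  assumes "walk 8 z 0 c"
  shows "(\<exists>z'. z = False # z' \<and> walk 4 z' 0 c) \<or> hoppable 8 z c"
proof -
  from assms consider "\<exists>z'. z = False # z' \<and> walk 4 z' 0 c" | z1 where "z = True # z1" "walk 11 z1 0 c"
    by (auto simp: walk_from(8)[of z])
  then show ?thesis
  proof cases
    case 2
    with hoppable_11_12[of z1 c] consider z3 where "z1 = True # False # z3" "walk 9 z3 0 c" | "hoppable 11 z1 c" by blast
    then have "hoppable 8 z c"
    proof cases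
      case 1
      then show ?thesis using 2
        by (auto simp: walk_Cons_iff intro!: hoppable_110[where q=9 and k=0 and c=c])
    qed (use 2 in \<open>auto intro: hoppable_Cons0[of 8 11]\<close>)
    then show ?thesis ..
  qed blast
qed

lemma hoppable_5:
  assumes "walk 5 z 0 c"
  shows "(\<exists>z'. z = True # False # z' \<and> walk 4 z' 0 c) \<or> hoppable 5 z c"
proof -
  from assms consider z1 where "z = True # z1" "walk 8 z1 0 c" | z1 where "z = False # True # True # z1" "walk 6 z1 0 c"
    by (auto simp: walk_from(5)[of z] walk_from(7,10))
  then show ?thesis
  proof cases
    case 1
    then show ?thesis using hoppable_8[of z1 c] by (auto intro: hoppable_Cons0[of 5 8])
  next
    case 2
    then show ?thesis
      by (auto simp: walk_Cons_iff intro!: hoppable_011[where q=6 and k=0 and c=c])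
  qed
qed

lemma hoppable_3:
  assumes "walk 3 z 0 c"
  shows "(\<exists>z'. z = False # z' \<and> walk 1 z' 0 c) \<or> hoppable 3 z c"
proof -
  from assms consider "\<exists>z'. z = False # z' \<and> walk 1 z' 0 c" | z1 where "z = True # z1" "walk 5 z1 0 c"
    by (auto simp: walk_from(3)[of z])
  then show ?thesis
  proof cases
    case 2
    with hoppable_5[of z1 c] consider z3 where "z1 = True # False # z3" "walk 4 z3 0 c" | "hoppable 5 z1 c" by blast
    then have "hoppable 3 z c"
    proof cases
      case 1
      then show ?thesis using 2
        by (auto simp: walk_Cons_iff intro!: hoppable_110[where q=4 and k=0 and c=c])
    qed (use 2 in \<open>auto intro: hoppable_Cons0[of 3 5]\<close>)
    then show ?thesis ..
  qed blast
qed

text \<open>The first alternative is the piece \<open>11\<close>. In the second the window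
  \<open>110\<close> starts with the peg that led into state 1, so the hop can only be made from
  state 0.\<close>

lemma hoppable_1:
  assumes "walk 1 z 0 c"
  shows "(\<exists>z'. z = True # z' \<and> walk 0 z' 0 c) \<or> (\<exists>z'. z = True # False # z' \<and> walk 1 z' 0 c) \<or> hoppable 1 z c"
proof -
  from assms consider "\<exists>z'. z = True # z' \<and> walk 0 z' 0 c" | z1 where "z = True # z1" "walk 3 z1 0 c"
    | z2 where "z = False # True # z2" "walk 4 z2 0 c"
    unfolding walk_from(1)[of z] walk_from(2) by blast
  then show ?thesis
  proof cases
    case 2
    with hoppable_3[of z1 c] consider z2 where "z1 = False # z2" "walk 1 z2 0 c" | "hoppable 3 z1 c" by blast
    then show ?thesis
    proof cases
      case h: 2
      have "hoppable 1 z c" unfolding 2 by (rule hoppable_Cons0[OF _ h]) simp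
      then show ?thesis by blast
    qed (use 2 in blast)
  next
    case 3
    with hoppable_4[of z2 c] consider z3 where "z2 = True # z3" "walk 2 z3 0 c"
      | z3 where "z2 = True # z3" "walk 0 z3 0 c" | "hoppable 4 z2 c" by blast
    then have "hoppable 1 z c"
    proof cases
      case 1
      then show ?thesis using 3
        by (auto simp: walk_Cons_iff intro!: hoppable_011[where q=2 and k=0 and c=c])
    next
      case 2
      then show ?thesis using 3
        by (auto simp: walk_Cons_iff intro!: hoppable_011[where q=0 and k=0 and c=c])
    next
      case h: 3
      show ?thesis unfolding 3(1) by (rule hoppable_Cons_Cons0[of 1 2 _ 4, OF _ _ h]) auto
    qed
    then show ?thesis by blast
  qed blast
qed

lemma walk_0_cases:
  assumes "walk 0 z 0 c"
  obtains "z = []" "c = 0" | z' where "z = False # z'" "walk 0 z' 0 c"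
  | z' c' where "z = True # z'" "walk 0 z' 0 c'" "c = Suc c'"
  | z' c' where "z = True # True # z'" "walk 0 z' 0 c'" "c = Suc c'"
  | "hoppable 0 z c"
proof -
  from assms consider "z = []" "c = 0" | z' where "z = False # z'" "walk 0 z' 0 c"
    | z' c' where "z = True # z'" "walk 0 z' 0 c'" "c = Suc c'"
    | z' c' where "z = True # z'" "walk 1 z' 0 c'" "c = Suc c'"
    by (subst (asm) walk_word_eval) (auto simp: Suc_le_eq gr0_conv_Suc)
  then show thesis
  proof cases
    case 4
    from hoppable_1[OF 4(2)] consider z2 where "z' = True # z2" "walk 0 z2 0 c'"
      | z2 where "z' = True # False # z2" "walk 1 z2 0 c'" | "hoppable 1 z' c'" by blast
    then show thesis
    proof cases
      case 2
      \<comment> \<open>After \<open>110\<close> becomes \<open>001\<close>, the walk stays in state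
        0 over two holes and pays for the piece at the third letter: the same cost, paid
        later.\<close>
      then have "hoppable 0 z c" using 4
        by (auto simp: walk_Cons_iff intro!: hoppable_110[where q=1 and k=1 and c=c'])
      then show thesis by (fact that)
    next
      case 3
      then have "hoppable 0 z c" using 4
        by (auto intro: hoppable_Cons[of 0 1 1])
      then show thesis by (fact that)
    qed (use that 4 in auto)
  qed (use that in auto)
qed

text \<open>The run is cut into pieces \<open>11\<close>, with one single peg left over if
  \<open>m\<close> is odd.\<close>

lemma walk_ones: "\<exists>c. 2 * c \<le> m + 1 \<and> walk 0 (replicate m True) 0 c"
proof (induction m rule: induct_nat_012)
  case (ge2 m)
  then obtain c where "2 * c \<le> m + 1" "walk 0 (replicate m True) 0 c" by blast
  moreover from this have "walk 1 (True # replicate m True) 0 (0 + c)"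
    by (intro walk.Cons[of 1 0]) auto
  then have "walk 0 (True # True # replicate m True) 0 (1 + (0 + c))"
    by (intro walk.Cons[of 0 1]) auto
  ultimately show ?case by (intro exI[of _ "1 + (0 + c)"]) auto
qed (auto simp: walk_Cons_iff)

lemma hoppable_ones_prepend: "hoppable 0 z c \<Longrightarrow> hoppable 0 (replicate r True @ z) (r + c)"
  by (induction r) (auto intro: hoppable_Cons[where q=0 and k=1])

text \<open>A walk cheaper than the number of pegs uses a piece with several pegs. By
  \<open>walk_0_cases\<close> only \<open>11\<close> is problematic, and the search for a hole next
  to it fails only on a word of pegs. The bound \<open>length w \<le> 2 * c\<close> is what the
  induction needs when a hole is put in front of such a word.\<close>

lemma hoppable_or_ones:
  assumes "walk 0 w 0 c" "c < pegs w"
  shows "hoppable 0 w c \<or> (w = replicate (length w) True \<and> length w \<le> 2 * c)"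
  using assms
proof (induction w arbitrary: c rule: length_induct)
  case (1 w)
  have IH: "hoppable 0 z c' \<or> (z = replicate (length z) True \<and> length z \<le> 2 * c')"
    if "length z < length w" "walk 0 z 0 c'" "c' < pegs z" for z c'
    using 1(1) that by blast
  from 1(2) show ?case
  proof (cases rule: walk_0_cases)
    case (2 z)
    then consider "hoppable 0 z c" | "z = replicate (length z) True" "length z \<le> 2 * c"
      using IH[of z c] 1(3) by auto
    then have "hoppable 0 w c"
    proof cases
      case 1
      then show ?thesis using 2 by (auto intro: hoppable_Cons0[of 0 0])
    next
      case ones: 2
      have "c < length z" using 2 1(3) pegs_le_length[of z] by simp
      with ones(2) obtain m where m: "length z = Suc (Suc m)"
        by (metis One_nat_def Suc_lessE le_zero_eq less_Suc0 less_nat_zero_code mult_0_right not_less_eq old.nat.exhaust)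
      \<comment> \<open>The hop turns \<open>011\<close> into \<open>100\<close>, that is, one
        single peg and a run of \<open>m\<close> pegs. As \<open>m + 2 \<le> 2 * c\<close> and
        \<open>2 * c' \<le> m + 1\<close>, the new cost \<open>1 + c'\<close> is at most
        \<open>c\<close>.\<close>
      obtain c' where c': "2 * c' \<le> m + 1" "walk 0 (replicate m True) 0 c'" using walk_ones by blast
      have "z = True # True # replicate m True" using ones(1) m by simp
      then show ?thesis using 2 c' ones(2) m
        by (auto simp: walk_Cons_iff intro!: hoppable_011[where q=0 and k=1 and c=c'])
    qed
    then show ?thesis ..
  next
    case (3 z c')
    then consider "hoppable 0 z c'" | "z = replicate (length z) True" "length z \<le> 2 * c'"
      using IH[of z c'] 1(3) by auto
    then show ?thesis
      using 3 by cases (auto intro: hoppable_Cons[of 0 0 1])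
  next
    case (4 z c')
    consider "c' < pegs z" | "pegs z \<le> c'" "False \<in> set z" | "pegs z \<le> c'" "False \<notin> set z" by linarith
    then show ?thesis
    proof cases
      case 1
      then consider "hoppable 0 z c'" | "z = replicate (length z) True" "length z \<le> 2 * c'"
        using IH[of z c'] 4 by auto
      then show ?thesis
      proof cases
        case 1
        then have "hoppable 1 (True # z) c'" by (rule hoppable_Cons0[rotated]) simp
        then have "hoppable 0 w c" unfolding 4 by (rule hoppable_Cons[rotated]) auto
        then show ?thesis ..
      qed (use 4 in auto)
    next
      case 2
      \<comment> \<open>Only pegs precede the first hole, so \<open>w\<close> begins with pegs
        ending in a window \<open>110\<close>. After the hop all pegs are counted singly: there are
        \<open>pegs z + 1\<close> of them, and \<open>pegs z \<le> c'\<close> makes this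
        affordable.\<close>
      then obtain u v where z: "z = u @ False # v" "False \<notin> set u" by (meson split_list_first)
      define r where "r = length u"
      have u: "u = replicate r True" unfolding r_def using z(2)
        by (metis (full_types) replicate_length_same)
      have w: "w = replicate r True @ True # True # False # v"
        unfolding 4 z u by (simp add: replicate_app_Cons_same)
      have "hoppable 0 (True # True # False # v) (1 + pegs v)"
        by (rule hoppable_110[where q=0 and k=1, OF _ walk_singles]) (auto simp: walk_Cons_iff)
      from hoppable_ones_prepend[OF this, of r]
      have "hoppable 0 w (r + (1 + pegs v))" using w by simp
      moreover have "pegs z = r + pegs v" using z u by (induction r) (auto simp: pegs_def)
      ultimately show ?thesis using 2 4 hoppable_mono[of 0 w _ c] by simp
    next
      case 3
      have "z = replicate (length z) True" using 3 by (metis (full_types) replicate_length_same)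
      then have "pegs z = length z" by (metis (mono_tags) filter_True id_apply in_set_replicate pegs_def)
      then show ?thesis using 3 4 \<open>z = _\<close> by auto
    qed
  qed (use 1 in auto)
qed

section \<open>Structured programs for the RAM\<close>

type_synonym mem = "int \<Rightarrow> int"

text \<open>Without loops every instruction runs at most once, so the code length
  \<open>clen\<close> is also a bound on the running time.\<close>

datatype com = Block "instr list" | Seq com com (infixr \<open>;;\<close> 60) | IfPos int com com

text \<open>The program counter 0 is arbitrary: straight-line instructions change the memory
  independently of it.\<close>

definition run :: "instr list \<Rightarrow> mem \<Rightarrow> mem" where
  "run is m = fold (\<lambda>i m. snd (exec i (0, m))) is m"

lemma run_simps [simp]: "run [] m = m" "run (i # is) m = run is (snd (exec i (0, m)))"
  "run (is @ js) m = run js (run is m)"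
  by (simp_all add: run_def)

fun ev :: "com \<Rightarrow> mem \<Rightarrow> mem" where
  "ev (Block is) m = run is m"
| "ev (c ;; d) m = ev d (ev c m)"
| "ev (IfPos r c d) m = (if m r > 0 then ev c m else ev d m)"

fun clen :: "com \<Rightarrow> nat" where
  "clen (Block is) = length is"
| "clen (c ;; d) = clen c + clen d"
| "clen (IfPos r c d) = clen c + clen d + 2"

text \<open>Jump targets are absolute, hence the start address \<open>p\<close>. The negative branch
  comes first because it is reached by falling through.\<close>

fun compile :: "nat \<Rightarrow> com \<Rightarrow> instr list" where
  "compile p (Block is) = is"
| "compile p (c ;; d) = compile p c @ compile (p + clen c) d"
| "compile p (IfPos r c d) =
     Jpos r (p + clen d + 2) # compile (p + 1) d @
     Jmp (p + clen d + 2 + clen c) # compile (p + clen d + 2) c"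

fun straight :: "instr \<Rightarrow> bool" where
  "straight (Jz _ _) = False"
| "straight (Jpos _ _) = False"
| "straight (Jmp _) = False"
| "straight Halt = False"
| "straight _ = True"

fun wf_com :: "com \<Rightarrow> bool" where
  "wf_com (Block is) \<longleftrightarrow> list_all straight is"
| "wf_com (c ;; d) \<longleftrightarrow> wf_com c \<and> wf_com d"
| "wf_com (IfPos r c d) \<longleftrightarrow> wf_com c \<and> wf_com d"

lemma length_compile [simp]: "length (compile p c) = clen c"
  by (induction p c rule: compile.induct) auto

definition reaches :: "instr list \<Rightarrow> config \<Rightarrow> nat \<Rightarrow> config \<Rightarrow> bool" where
  "reaches P s T s' \<longleftrightarrow> (\<exists>t \<le> T. (step P ^^ t) s = s')"

lemma reaches_refl: "reaches P s T s"
  unfolding reaches_def by (intro exI[of _ 0]) simp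

lemma reaches_step: "step P s = s' \<Longrightarrow> 1 \<le> T \<Longrightarrow> reaches P s T s'"
  unfolding reaches_def by (intro exI[of _ 1]) simp

lemma reaches_mono: "reaches P s T s' \<Longrightarrow> T \<le> T' \<Longrightarrow> reaches P s T' s'"
  unfolding reaches_def using le_trans by blast

lemma reaches_trans:
  assumes "reaches P s T s'" "reaches P s' T' s''"
  shows "reaches P s (T + T') s''"
proof -
  from assms obtain t t' where "t \<le> T" "(step P ^^ t) s = s'" "t' \<le> T'" "(step P ^^ t') s' = s''"
    by (auto simp: reaches_def)
  then have "t' + t \<le> T + T'" "(step P ^^ (t' + t)) s = s''" by (auto simp: funpow_add)
  then show ?thesis unfolding reaches_def by blast
qed

lemma fetch_middle [simp]: "fetch (pre @ i # post) (length pre) = i"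
  by (simp add: fetch_def)

lemma step_Jpos:
  "P = pre @ Jpos r l # post \<Longrightarrow> p = length pre \<Longrightarrow>
   step P (p, m) = (if m r > 0 then l else p + 1, m)"
  by (simp add: step_def)

lemma step_Jmp: "P = pre @ Jmp l # post \<Longrightarrow> p = length pre \<Longrightarrow> step P (p, m) = (l, m)"
  by (simp add: step_def)

lemma reaches_Block:
  assumes "P = pre @ is @ post" "list_all straight is"
  shows "reaches P (length pre, m) (length is) (length pre + length is, run is m)"
  using assms
proof (induction "is" arbitrary: pre m)
  case (Cons i "is")
  have "step P (length pre, m) = (length pre + 1, snd (exec i (0, m)))"
    using Cons.prems by (cases i) (auto simp: step_def)
  moreover have "reaches P (length (pre @ [i]), snd (exec i (0, m))) (length is)
      (length (pre @ [i]) + length is, run is (snd (exec i (0, m))))"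
    using Cons.prems by (intro Cons.IH) auto
  ultimately show ?case
    using reaches_trans[OF reaches_step[of P _ _ 1]] by fastforce
qed (simp add: reaches_refl)

lemma reaches_compile:
  assumes "P = pre @ compile (length pre) c @ post" "wf_com c"
  shows "reaches P (length pre, m) (clen c) (length pre + clen c, ev c m)"
  using assms
proof (induction c arbitrary: pre post m)
  case (Block "is")
  then show ?case using reaches_Block by simp
next
  case (Seq c d)
  have 1: "reaches P (length pre, m) (clen c) (length pre + clen c, ev c m)"
    using Seq.prems by (intro Seq.IH(1)) auto
  have "reaches P (length (pre @ compile (length pre) c), ev c m) (clen d)
    (length (pre @ compile (length pre) c) + clen d, ev d (ev c m))"
    using Seq.prems by (intro Seq.IH(2)) auto
  with reaches_trans[OF 1] show ?case by (simp add: add.assoc)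
next
  case (IfPos r c d)
  let ?p = "length pre"
  have P: "P = pre @ Jpos r (?p + clen d + 2) # compile (?p + 1) d @
     Jmp (?p + clen d + 2 + clen c) # compile (?p + clen d + 2) c @ post"
    using IfPos.prems by simp
  have j: "reaches P (?p, m) 1 (if m r > 0 then ?p + clen d + 2 else ?p + 1, m)"
    by (rule reaches_step[OF step_Jpos[OF P]]) auto
  show ?case
  proof (cases "m r > 0")
    case True
    let ?pre = "pre @ Jpos r (?p + clen d + 2) # compile (?p + 1) d @ [Jmp (?p + clen d + 2 + clen c)]"
    have "reaches P (length ?pre, m) (clen c) (length ?pre + clen c, ev c m)"
      using IfPos.prems by (intro IfPos.IH(1)) auto
    then have "reaches P (?p + clen d + 2, m) (clen c) (?p + clen d + 2 + clen c, ev c m)"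
      by (simp add: algebra_simps)
    with j True have "reaches P (?p, m) (1 + clen c) (?p + clen d + 2 + clen c, ev c m)"
      using reaches_trans by fastforce
    then show ?thesis using True by (auto intro: reaches_mono simp: algebra_simps)
  next
    case False
    let ?pre = "pre @ [Jpos r (?p + clen d + 2)]"
    have "reaches P (length ?pre, m) (clen d) (length ?pre + clen d, ev d m)"
      using IfPos.prems by (intro IfPos.IH(2)) auto
    then have d: "reaches P (?p + 1, m) (clen d) (?p + 1 + clen d, ev d m)" by simp
    have e: "reaches P (?p + 1 + clen d, ev d m) 1 (?p + clen d + 2 + clen c, ev d m)"
      by (rule reaches_step[OF step_Jmp[of P "pre @ Jpos r (?p + clen d + 2) # compile (?p + 1) d"]])
        (auto simp: P)
    from j False have "reaches P (?p, m) 1 (?p + 1, m)" by simp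
    from reaches_trans[OF reaches_trans[OF this d] e] show ?thesis
      using False by (auto intro: reaches_mono simp: algebra_simps)
  qed
qed

definition while_code :: "nat \<Rightarrow> int \<Rightarrow> com \<Rightarrow> instr list" where
  "while_code p r c = Jpos r (p + 2) # Jmp (p + 3 + clen c) # compile (p + 2) c @ [Jmp p]"

lemma length_while_code [simp]: "length (while_code p r c) = clen c + 3"
  by (simp add: while_code_def)

text \<open>The variant \<open>k\<close> is an argument of the invariant, not a function of the
  memory, because it will depend on a word that the memory only represents. Each round costs two
  more than the body, for the test and the jump back; the last 2 is the failing test and the exit
  jump.\<close>

lemma reaches_while:
  assumes P: "P = pre @ while_code (length pre) r c @ post" and wf: "wf_com c"
    and inv: "I k m"
    and body: "\<And>k m. I k m \<Longrightarrow> m r > 0 \<Longrightarrow> \<exists>k' < k. I k' (ev c m)"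
  shows "\<exists>k' m'. I k' m' \<and> \<not> m' r > 0 \<and>
    reaches P (length pre, m) ((clen c + 2) * k + 2) (length pre + clen c + 3, m')"
  using inv
proof (induction k arbitrary: m rule: less_induct)
  case (less k)
  let ?p = "length pre"
  have P': "P = pre @ Jpos r (?p + 2) # Jmp (?p + 3 + clen c) # compile (?p + 2) c @ Jmp ?p # post"
    using P by (simp add: while_code_def)
  have j: "reaches P (?p, m) 1 (if m r > 0 then ?p + 2 else ?p + 1, m)"
    by (rule reaches_step[OF step_Jpos[OF P']]) auto
  show ?case
  proof (cases "m r > 0")
    case True
    obtain k' where k': "k' < k" "I k' (ev c m)" using body less.prems True by blast
    let ?pre = "pre @ [Jpos r (?p + 2), Jmp (?p + 3 + clen c)]"
    have "reaches P (length ?pre, m) (clen c) (length ?pre + clen c, ev c m)"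
      using P' wf by (intro reaches_compile) auto
    then have b: "reaches P (?p + 2, m) (clen c) (?p + 2 + clen c, ev c m)" by simp
    have e: "reaches P (?p + 2 + clen c, ev c m) 1 (?p, ev c m)"
      by (rule reaches_step[OF step_Jmp[of P "?pre @ compile (?p + 2) c"]]) (auto simp: P')
    from less.IH[OF k'] obtain k'' m' where m': "I k'' m'" "\<not> m' r > 0"
      "reaches P (?p, ev c m) ((clen c + 2) * k' + 2) (?p + clen c + 3, m')" by blast
    from j True have "reaches P (?p, m) 1 (?p + 2, m)" by simp
    from reaches_trans[OF reaches_trans[OF reaches_trans[OF this b] e] m'(3)]
    have "reaches P (?p, m) (1 + clen c + 1 + ((clen c + 2) * k' + 2)) (?p + clen c + 3, m')" .
    moreover have "1 + clen c + 1 + ((clen c + 2) * k' + 2) = (clen c + 2) * Suc k' + 2" by simp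
    moreover have "(clen c + 2) * Suc k' \<le> (clen c + 2) * k" using k'(1) by (intro mult_le_mono2) simp
    ultimately have "reaches P (?p, m) ((clen c + 2) * k + 2) (?p + clen c + 3, m')"
      using reaches_mono by (metis add_le_mono1)
    with m' show ?thesis by blast
  next
    case False
    have e: "reaches P (?p + 1, m) 1 (?p + 3 + clen c, m)"
      by (rule reaches_step[OF step_Jmp[of P "pre @ [Jpos r (?p + 2)]"]]) (auto simp: P')
    from j False have "reaches P (?p, m) 1 (?p + 1, m)" by simp
    from reaches_trans[OF this e] have "reaches P (?p, m) ((clen c + 2) * k + 2) (?p + clen c + 3, m)"
      by (auto intro: reaches_mono simp: algebra_simps)
    with less.prems False show ?thesis by blast
  qed
qed

section \<open>Min-plus vector operations\<close>

text \<open>Working memory sits at negative addresses, because the input and the output occupy the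
  addresses from 0 upwards. Scratch registers have addresses between -60 and -15, tape records start
  at -100.\<close>

abbreviation rQ :: int where "rQ \<equiv> -1"
abbreviation rREM :: int where "rREM \<equiv> -2"
abbreviation rPOS :: int where "rPOS \<equiv> -3"
abbreviation rOUT :: int where "rOUT \<equiv> -4"
abbreviation rG :: int where "rG \<equiv> -5"
abbreviation rINF :: int where "rINF \<equiv> -6"
abbreviation rX1 :: int where "rX1 \<equiv> -7"
abbreviation rX2 :: int where "rX2 \<equiv> -8"
abbreviation rX3 :: int where "rX3 \<equiv> -9"
abbreviation rC :: int where "rC \<equiv> -11"
abbreviation rF :: int where "rF \<equiv> -15"
abbreviation rT :: int where "rT \<equiv> -16"
abbreviation rT2 :: int where "rT2 \<equiv> -17"
abbreviation rX :: int where "rX \<equiv> -18"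
abbreviation rV :: int where "rV \<equiv> -19"
abbreviation rA :: "nat \<Rightarrow> int" where "rA s \<equiv> -20 - int s"
abbreviation rB :: "nat \<Rightarrow> int" where "rB s \<equiv> -40 - int s"

definition scratch :: "int set" where "scratch = {-60..-15}"

definition load_vec :: "int \<Rightarrow> nat \<Rightarrow> instr list" where
  "load_vec off k = concat (map (\<lambda>s. [Const rT (off - int s), Add rT rQ rT, Load (rA s) rT]) [0..<k])"

definition store_vec :: "int \<Rightarrow> nat \<Rightarrow> instr list" where
  "store_vec off k = concat (map (\<lambda>s. [Const rT (off - int s), Add rT rQ rT, Store rT (rB s)]) [0..<k])"

text \<open>Adding a register that holds 0 serves as a move instruction, here and below.\<close>

definition init_vec :: "nat \<Rightarrow> instr list" where
  "init_vec k = concat (map (\<lambda>s. [Const rT 0, Add (rB s) rINF rT]) [0..<k])"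

definition relax :: "nat \<times> nat \<times> nat \<Rightarrow> com" where
  "relax e = (case e of (s, t, k) \<Rightarrow>
     Block [Const rT (int k), Add rT (rA s) rT, Sub rT2 (rB t) rT] ;;
     IfPos rT2 (Block [Const rT2 0, Add (rB t) rT rT2]) (Block []))"

definition dot_term :: "nat \<Rightarrow> com" where
  "dot_term s =
     Block [Const rT (-1 - int s), Add rT rQ rT, Load rT rT,
            Const rT2 (-20 - int s), Add rT2 rQ rT2, Load rT2 rT2,
            Add rT rT rT2, Sub rT2 rV rT] ;;
     IfPos rT2 (Block [Const rT2 0, Add rV rT rT2]) (Block [])"

definition seqs :: "com list \<Rightarrow> com" where
  "seqs cs = foldr Seq cs (Block [])"

lemma seqs_simps [simp]: "seqs [] = Block []" "seqs (c # cs) = c ;; seqs cs"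
  by (simp_all add: seqs_def)

lemma ev_seqs_append: "ev (seqs (cs @ ds)) m = ev (seqs ds) (ev (seqs cs) m)"
  by (induction cs arbitrary: m) auto

text \<open>A product of a vector with a transition matrix over (min,+), where the letter in
  \<open>rX\<close> selects the matrix.\<close>

definition vstep :: "int \<Rightarrow> int \<Rightarrow> (nat \<times> nat \<times> nat) list \<Rightarrow> (nat \<times> nat \<times> nat) list \<Rightarrow> com" where
  "vstep off off' L0 L1 =
     Block (load_vec off 13 @ init_vec 13) ;;
     IfPos rX (seqs (map relax L1)) (seqs (map relax L0)) ;;
     Block (store_vec off' 13)"

definition dot :: com where
  "dot = Block [Const rT 0, Add rV rINF rT] ;; seqs (map dot_term [0..<13])"

lemma load_vec:
  assumes "k \<le> 13" "m rQ + off < -60"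
  shows "s < k \<Longrightarrow> run (load_vec off k) m (rA s) = m (m rQ + off - int s)"
    and "a \<notin> scratch \<Longrightarrow> run (load_vec off k) m a = m a"
proof -
  have "(\<forall>s<k. run (load_vec off k) m (rA s) = m (m rQ + off - int s)) \<and>
    (\<forall>a. a \<notin> scratch \<longrightarrow> run (load_vec off k) m a = m a)"
    using assms
  proof (induction k)
    case (Suc k)
    define m1 where "m1 = run (load_vec off k) m"
    from Suc have IH: "\<And>s. s < k \<Longrightarrow> m1 (rA s) = m (m rQ + off - int s)"
      "\<And>a. a \<notin> scratch \<Longrightarrow> m1 a = m a" by (auto simp: m1_def)
    have Q: "m1 rQ = m rQ" by (rule IH(2)) (simp add: scratch_def)
    have v: "m1 (m rQ + off - int k) = m (m rQ + off - int k)"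
      using Suc.prems by (intro IH(2)) (auto simp: scratch_def)
    have "run (load_vec off (Suc k)) m = m1(rT := m rQ + off - int k, rA k := m (m rQ + off - int k))"
      using Q v Suc.prems unfolding m1_def
      by (auto simp: load_vec_def algebra_simps)
    then show ?case using IH Suc.prems by (auto simp: scratch_def less_Suc_eq)
  qed (simp add: load_vec_def)
  then show "s < k \<Longrightarrow> run (load_vec off k) m (rA s) = m (m rQ + off - int s)"
    and "a \<notin> scratch \<Longrightarrow> run (load_vec off k) m a = m a" by blast+
qed

lemma init_vec:
  assumes "k \<le> 13"
  shows "s < k \<Longrightarrow> run (init_vec k) m (rB s) = m rINF"
    and "s < 13 \<Longrightarrow> run (init_vec k) m (rA s) = m (rA s)"
    and "a \<notin> scratch \<Longrightarrow> run (init_vec k) m a = m a"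
    and "run (init_vec k) m rX = m rX"
proof -
  have "(\<forall>s<k. run (init_vec k) m (rB s) = m rINF) \<and>
    (\<forall>s<13. run (init_vec k) m (rA s) = m (rA s)) \<and>
    (\<forall>a. a \<notin> scratch \<longrightarrow> run (init_vec k) m a = m a) \<and> run (init_vec k) m rX = m rX"
    using assms
  proof (induction k)
    case (Suc k)
    define m1 where "m1 = run (init_vec k) m"
    have "m1 rINF = m rINF" using Suc unfolding m1_def by (auto simp: scratch_def)
    then have "run (init_vec (Suc k)) m = m1(rT := 0, rB k := m rINF)"
      unfolding m1_def by (auto simp: init_vec_def)
    then show ?case using Suc unfolding m1_def by (auto simp: scratch_def less_Suc_eq)
  qed (simp add: init_vec_def)
  then show "s < k \<Longrightarrow> run (init_vec k) m (rB s) = m rINF"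
    and "s < 13 \<Longrightarrow> run (init_vec k) m (rA s) = m (rA s)"
    and "a \<notin> scratch \<Longrightarrow> run (init_vec k) m a = m a"
    and "run (init_vec k) m rX = m rX" by blast+
qed

lemma store_vec:
  assumes "k \<le> 13" "m rQ + off < -60"
  shows "s < k \<Longrightarrow> run (store_vec off k) m (m rQ + off - int s) = m (rB s)"
    and "a \<noteq> rT \<Longrightarrow> a \<notin> {m rQ + off - 12..m rQ + off} \<Longrightarrow> run (store_vec off k) m a = m a"
proof -
  have "(\<forall>s<k. run (store_vec off k) m (m rQ + off - int s) = m (rB s)) \<and>
    (\<forall>a. a \<noteq> rT \<longrightarrow> (\<forall>s<k. a \<noteq> m rQ + off - int s) \<longrightarrow> run (store_vec off k) m a = m a)"
    using assms
  proof (induction k)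
    case (Suc k)
    define m1 where "m1 = run (store_vec off k) m"
    from Suc have IH: "\<And>s. s < k \<Longrightarrow> m1 (m rQ + off - int s) = m (rB s)"
      "\<And>a. a \<noteq> rT \<Longrightarrow> (\<forall>s<k. a \<noteq> m rQ + off - int s) \<Longrightarrow> m1 a = m a" by (auto simp: m1_def)
    have Q: "m1 rQ = m rQ" using Suc.prems by (intro IH(2)) auto
    have v: "m1 (rB k) = m (rB k)" using Suc.prems by (intro IH(2)) auto
    have "run (store_vec off (Suc k)) m = m1(rT := m rQ + off - int k, m rQ + off - int k := m (rB k))"
      using Q v Suc.prems unfolding m1_def
      by (auto simp: store_vec_def algebra_simps)
    then show ?case using IH Suc.prems by (auto simp: less_Suc_eq)
  qed (simp add: store_vec_def)
  then show "s < k \<Longrightarrow> run (store_vec off k) m (m rQ + off - int s) = m (rB s)"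
    and "a \<noteq> rT \<Longrightarrow> a \<notin> {m rQ + off - 12..m rQ + off} \<Longrightarrow> run (store_vec off k) m a = m a"
    using assms(1) by auto
qed

lemma ev_relax:
  assumes "s < 13" "t < 13"
  shows "ev (relax (s, t, k)) m (rB t) = min (m (rB t)) (m (rA s) + int k)"
    and "a \<noteq> rT \<Longrightarrow> a \<noteq> rT2 \<Longrightarrow> a \<noteq> rB t \<Longrightarrow> ev (relax (s, t, k)) m a = m a"
  using assms by (auto simp: relax_def)

text \<open>Comparison with an arbitrary \<open>K\<close> characterises a minimum without a term for
  it, and turns minima into existential statements about walks.\<close>

lemma ev_relax_list:
  assumes "\<forall>(s, t, k) \<in> set L. s < 13 \<and> t < 13"
  shows "t < 13 \<Longrightarrow> ev (seqs (map relax L)) m (rB t) \<le> K \<longleftrightarrow>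
      m (rB t) \<le> K \<or> (\<exists>(s, t', k) \<in> set L. t' = t \<and> m (rA s) + int k \<le> K)"
    and "a \<notin> scratch \<Longrightarrow> ev (seqs (map relax L)) m a = m a"
proof -
  have "(\<forall>t < 13. ev (seqs (map relax L)) m (rB t) \<le> K \<longleftrightarrow>
      m (rB t) \<le> K \<or> (\<exists>(s, t', k) \<in> set L. t' = t \<and> m (rA s) + int k \<le> K)) \<and>
    (\<forall>a. a \<notin> scratch \<longrightarrow> ev (seqs (map relax L)) m a = m a)"
    using assms
  proof (induction L arbitrary: m)
    case (Cons e L)
    obtain s t k where e: "e = (s, t, k)" by (cases e)
    have st: "s < 13" "t < 13" using Cons.prems e by auto
    define m1 where "m1 = ev (relax e) m"
    have rA: "m1 (rA p) = m (rA p)" if "p < 13" for p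
      unfolding m1_def e using that st by (intro ev_relax(2)) auto
    have rB: "m1 (rB p) = (if p = t then min (m (rB t)) (m (rA s) + int k) else m (rB p))"
      if "p < 13" for p
      using ev_relax(1)[OF st] ev_relax(2)[OF st, of "rB p"] that unfolding m1_def e by auto
    have fr: "m1 a = m a" if "a \<notin> scratch" for a
      unfolding m1_def e using that st by (intro ev_relax(2)) (auto simp: scratch_def)
    have IH1: "\<And>t. t < 13 \<Longrightarrow> ev (seqs (map relax L)) m1 (rB t) \<le> K \<longleftrightarrow>
        m1 (rB t) \<le> K \<or> (\<exists>(s, t', k) \<in> set L. t' = t \<and> m1 (rA s) + int k \<le> K)"
      and IH2: "\<And>a. a \<notin> scratch \<Longrightarrow> ev (seqs (map relax L)) m1 a = m1 a"
      using Cons.IH[of m1] Cons.prems by auto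
    have *: "(\<exists>(s, t', k) \<in> set L. t' = p \<and> m1 (rA s) + int k \<le> K) \<longleftrightarrow>
      (\<exists>(s, t', k) \<in> set L. t' = p \<and> m (rA s) + int k \<le> K)" for p
      using Cons.prems rA by (intro bex_cong) auto
    have evm: "ev (seqs (map relax (e # L))) m = ev (seqs (map relax L)) m1" by (simp add: m1_def)
    have "ev (seqs (map relax (e # L))) m (rB p) \<le> K \<longleftrightarrow>
      m (rB p) \<le> K \<or> (\<exists>(s, t', k) \<in> set (e # L). t' = p \<and> m (rA s) + int k \<le> K)"
      if "p < 13" for p
      unfolding evm IH1[OF that] * rB[OF that] by (auto simp: e min_le_iff_disj)
    moreover have "\<forall>a. a \<notin> scratch \<longrightarrow> ev (seqs (map relax (e # L))) m a = m a"
      using IH2 fr by (simp add: m1_def[symmetric])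
    ultimately show ?case by blast
  qed simp
  then show "t < 13 \<Longrightarrow> ev (seqs (map relax L)) m (rB t) \<le> K \<longleftrightarrow>
      m (rB t) \<le> K \<or> (\<exists>(s, t', k) \<in> set L. t' = t \<and> m (rA s) + int k \<le> K)"
    and "a \<notin> scratch \<Longrightarrow> ev (seqs (map relax L)) m a = m a" by blast+
qed

lemma vstep:
  assumes L: "\<forall>(s, t, k) \<in> set L0 \<union> set L1. s < 13 \<and> t < 13"
    and off: "m rQ + off < -60" "m rQ + off' < -60"
  shows "t < 13 \<Longrightarrow> ev (vstep off off' L0 L1) m (m rQ + off' - int t) \<le> K \<longleftrightarrow> m rINF \<le> K \<or>
      (\<exists>(s, t', k) \<in> set (if m rX > 0 then L1 else L0). t' = t \<and> m (m rQ + off - int s) + int k \<le> K)"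
    and "a \<notin> scratch \<Longrightarrow> a \<notin> {m rQ + off' - 12..m rQ + off'} \<Longrightarrow> ev (vstep off off' L0 L1) m a = m a"
proof -
  define L where "L = (if m rX > 0 then L1 else L0)"
  define m1 where "m1 = run (load_vec off 13) m"
  define m2 where "m2 = run (init_vec 13) m1"
  define m3 where "m3 = ev (seqs (map relax L)) m2"
  have Lb: "\<forall>(s, t, k) \<in> set L. s < 13 \<and> t < 13" using L by (auto simp: L_def)
  \<comment> \<open>\<open>rX\<close> lies in the scratch area, so the frame part of
    \<open>load_vec\<close> does not cover it.\<close>
  have "m1 rX = m rX"
  proof -
    have "i \<le> 13 \<Longrightarrow> run (load_vec off i) m rX = m rX" for i
      by (induction i) (auto simp: load_vec_def)
    then show ?thesis by (simp add: m1_def)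
  qed
  then have X: "m2 rX = m rX" by (simp add: m2_def init_vec(4))
  have fr1: "m1 a = m a" if "a \<notin> scratch" for a
    unfolding m1_def using off that by (intro load_vec(2)) auto
  have fr2: "m2 a = m a" if "a \<notin> scratch" for a
    unfolding m2_def using fr1 that init_vec(3)[of 13 a m1] by auto
  have fr3: "m3 a = m a" if "a \<notin> scratch" for a
    unfolding m3_def using ev_relax_list(2)[OF Lb that] fr2 that by auto
  have Q: "m3 rQ = m rQ" by (rule fr3) (simp add: scratch_def)
  have ev: "ev (vstep off off' L0 L1) m = run (store_vec off' 13) m3"
    unfolding vstep_def m3_def by (simp add: m1_def[symmetric] m2_def[symmetric] X L_def)
  have A: "m2 (rA s) = m (m rQ + off - int s)" if "s < 13" for s
    unfolding m2_def using init_vec(2)[of 13 s m1] load_vec(1)[of 13 m off s] off that by (simp add: m1_def)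
  have B: "m2 (rB s) = m rINF" if "s < 13" for s
    unfolding m2_def using init_vec(1)[of 13 s m1] fr1[of rINF] that by (simp add: scratch_def)
  have *: "(\<exists>(s, t', k) \<in> set L. t' = t \<and> m2 (rA s) + int k \<le> K) \<longleftrightarrow>
      (\<exists>(s, t', k) \<in> set L. t' = t \<and> m (m rQ + off - int s) + int k \<le> K)" for t
    using Lb A by (intro bex_cong) auto
  show "ev (vstep off off' L0 L1) m (m rQ + off' - int t) \<le> K \<longleftrightarrow> m rINF \<le> K \<or>
      (\<exists>(s, t', k) \<in> set (if m rX > 0 then L1 else L0). t' = t \<and> m (m rQ + off - int s) + int k \<le> K)"
    if t: "t < 13"
  proof -
    have "ev (vstep off off' L0 L1) m (m rQ + off' - int t) = m3 (rB t)"
      unfolding ev using store_vec(1)[of 13 m3 off' t] Q off t by simp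
    then show ?thesis
      unfolding L_def[symmetric] m3_def using ev_relax_list(1)[OF Lb t, of m2 K] B[OF t] by (simp add: *)
  qed
  show "ev (vstep off off' L0 L1) m a = m a" if "a \<notin> scratch" "a \<notin> {m rQ + off' - 12..m rQ + off'}"
    unfolding ev using store_vec(2)[of 13 m3 off' a] Q off that fr3[OF that(1)] by (auto simp: scratch_def)
qed

lemma ev_dot_terms:
  assumes "m rQ < -60"
  shows "ev (seqs (map dot_term [0..<i])) m rV \<le> K \<longleftrightarrow>
      m rV \<le> K \<or> (\<exists>s<i. m (m rQ - 1 - int s) + m (m rQ - 20 - int s) \<le> K)" (is ?V)
    and "a \<notin> scratch \<Longrightarrow> ev (seqs (map dot_term [0..<i])) m a = m a"
proof -
  have "?V \<and> (\<forall>a. a \<notin> scratch \<longrightarrow> ev (seqs (map dot_term [0..<i])) m a = m a)"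
  proof (induction i)
    case (Suc i)
    define m1 where "m1 = ev (seqs (map dot_term [0..<i])) m"
    have e: "ev (seqs (map dot_term [0..<Suc i])) m = ev (dot_term i) m1"
      by (simp add: ev_seqs_append m1_def)
    have fr: "m1 a = m a" if "a \<notin> scratch" for a using Suc that by (simp add: m1_def)
    have Q: "m1 rQ = m rQ" by (rule fr) (simp add: scratch_def)
    have a: "m1 (m rQ - 1 - int i) = m (m rQ - 1 - int i)" "m1 (m rQ - 20 - int i) = m (m rQ - 20 - int i)"
      using assms by (auto intro!: fr simp: scratch_def)
    have "ev (dot_term i) m1 rV = min (m1 rV) (m (m rQ - 1 - int i) + m (m rQ - 20 - int i))"
      and fr': "\<And>a. a \<notin> scratch \<Longrightarrow> ev (dot_term i) m1 a = m1 a"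
      using assms a Q by (auto simp: dot_term_def scratch_def algebra_simps)
    then show ?case using Suc fr unfolding e m1_def[symmetric]
      by (auto simp: min_le_iff_disj less_Suc_eq)
  qed simp
  then show ?V and "a \<notin> scratch \<Longrightarrow> ev (seqs (map dot_term [0..<i])) m a = m a" by blast+
qed

lemma ev_dot:
  assumes "m rQ < -60"
  shows "ev dot m rV \<le> K \<longleftrightarrow>
      m rINF \<le> K \<or> (\<exists>s<13. m (m rQ - 1 - int s) + m (m rQ - 20 - int s) \<le> K)"
    and "a \<notin> scratch \<Longrightarrow> ev dot m a = m a"
proof -
  define m1 where "m1 = m(rT := 0, rV := m rINF)"
  have Q: "m1 rQ = m rQ" by (simp add: m1_def)
  have e: "ev dot m = ev (seqs (map dot_term [0..<13])) m1"
    unfolding dot_def m1_def by simp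
  have *: "m1 (m rQ - 1 - int s) = m (m rQ - 1 - int s)" "m1 (m rQ - 20 - int s) = m (m rQ - 20 - int s)" for s
    using assms by (auto simp: m1_def)
  show "ev dot m rV \<le> K \<longleftrightarrow>
      m rINF \<le> K \<or> (\<exists>s<13. m (m rQ - 1 - int s) + m (m rQ - 20 - int s) \<le> K)"
    unfolding e using ev_dot_terms(1)[of m1 13 K] assms Q by (simp add: * del: upt_rec_numeral) (simp add: m1_def)
  show "a \<notin> scratch \<Longrightarrow> ev dot m a = m a"
    unfolding e using ev_dot_terms(2)[of m1 a 13] assms Q by (auto simp: m1_def scratch_def)
qed

text \<open>Records are numbered by the length of the remaining suffix, so that the position of the first
  one does not depend on the input length. At offset 0 a record holds the first letter of that suffix,
  at offsets -1 to -13 the cheapest costs of reaching each state by the prefix, at offsets -20 to -32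
  the cheapest costs of reaching state 0 by the suffix.\<close>

definition rec_addr :: "nat \<Rightarrow> int" where "rec_addr r = -100 - 40 * int r"

lemma rec_bound: "rec_addr r \<le> -100"
  by (simp add: rec_addr_def)

lemma rec_shift: "i < n \<Longrightarrow> rec_addr (n - i) = rec_addr (n - Suc i) - 40"
  by (simp add: rec_addr_def of_nat_diff)

text \<open>Records lie 40 apart and offsets stay below 40, so an address determines its record and
  its offset. All disjointness arguments for the tape rest on this.\<close>

lemma rec_offset_between:
  assumes "rec_addr r - x \<in> {rec_addr r' - hi..rec_addr r' - lo}" "0 \<le> x" "x < 40" "0 \<le> lo" "hi < 40"
  shows "r = r' \<and> lo \<le> x \<and> x \<le> hi"
proof -
  have b: "40 * int r + x \<le> 40 * int r' + hi" "40 * int r' + lo \<le> 40 * int r + x"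
    using assms(1) by (auto simp: rec_addr_def)
  then have "int r < int r' + 1" "int r' < int r + 1" using assms by linarith+
  then have "r = r'" by simp
  then show ?thesis using b by simp
qed

definition peg_bit :: "bool \<Rightarrow> int" where "peg_bit b = (if b then 1 else 0)"

text \<open>The number \<open>x\<close> stands for the least element of \<open>S\<close>, any value above \<open>n\<close> standing for
  infinity.\<close>

definition rep :: "nat \<Rightarrow> int \<Rightarrow> (nat \<Rightarrow> bool) \<Rightarrow> bool" where
  "rep n x S \<longleftrightarrow> (\<forall>K \<le> int n. x \<le> K \<longleftrightarrow> (\<exists>c. S c \<and> int c \<le> K))"

definition prefix_ok :: "nat \<Rightarrow> mem \<Rightarrow> bool list \<Rightarrow> nat \<Rightarrow> bool" where
  "prefix_ok n m w i \<longleftrightarrow> (\<forall>s<13. rep n (m (rec_addr (n - i) - 1 - int s)) (walk 0 (take i w) s))"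

definition suffix_ok :: "nat \<Rightarrow> mem \<Rightarrow> bool list \<Rightarrow> nat \<Rightarrow> bool" where
  "suffix_ok n m w i \<longleftrightarrow> (\<forall>s<13. rep n (m (rec_addr (n - i) - 20 - int s)) (walk s (drop i w) 0))"

text \<open>The position is kept in three forms: as a record address, as the distance from the left
  end for the border test and the output, and as the distance from the right end for the loop
  test.\<close>

definition cursor :: "nat \<Rightarrow> mem \<Rightarrow> nat \<Rightarrow> bool" where
  "cursor n m i \<longleftrightarrow> m rQ = rec_addr (n - i) \<and> m rPOS = int i \<and> m rREM = int n - int i \<and> m rINF = int n + 1"

text \<open>The letters are valid from position \<open>l\<close> on, the prefix costs before position \<open>a\<close> and the suffix
  costs from position \<open>b\<close> on.\<close>

definition tape :: "nat \<Rightarrow> mem \<Rightarrow> bool list \<Rightarrow> nat \<Rightarrow> nat \<Rightarrow> nat \<Rightarrow> bool" where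
  "tape n m w l a b \<longleftrightarrow> length w = n \<and> (\<forall>k<n. l \<le> k \<longrightarrow> m (rec_addr (n - k)) = peg_bit (w ! k)) \<and>
     (\<forall>k<a. prefix_ok n m w k) \<and> (\<forall>k\<le>n. b \<le> k \<longrightarrow> suffix_ok n m w k)"

text \<open>The protected addresses are the input/output area and the control registers; the exempt
  ones, -3 to -1, hold the cursor.\<close>

definition keeps :: "mem \<Rightarrow> mem \<Rightarrow> bool" where
  "keeps m m' \<longleftrightarrow> (\<forall>a. -14 \<le> a \<and> a \<notin> {-3..-1} \<longrightarrow> m' a = m a)"

text \<open>Suffix costs propagate from the target of an edge to its source; reversing the edges
  lets \<open>vstep\<close> serve both directions.\<close>

definition rev_edges :: "bool \<Rightarrow> (nat \<times> nat \<times> nat) list" where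
  "rev_edges b = map (\<lambda>(p, q, k). (q, p, k)) (edges b)"

text \<open>The next position has the record 40 addresses higher, so its prefix field is at
  \<open>40 - 1 = 39\<close>. In \<open>left\<close> the pointer moves first, and the old suffix
  field is then at \<open>40 - 20 = 20\<close>.\<close>

definition right :: com where
  "right = Block [Load rX rQ] ;; vstep (-1) 39 (edges False) (edges True) ;;
     Block [Const rT 40, Add rQ rQ rT, Const rT 1, Add rPOS rPOS rT, Sub rREM rREM rT]"

definition left :: com where
  "left = Block [Const rT 40, Sub rQ rQ rT, Load rX rQ] ;;
     vstep 20 (-20) (rev_edges False) (rev_edges True) ;;
     Block [Const rT 1, Sub rPOS rPOS rT, Add rREM rREM rT]"

section \<open>Correctness of the cursor moves and of the cost query\<close>

lemma keeps_trans: "keeps m m' \<Longrightarrow> keeps m' m'' \<Longrightarrow> keeps m m''"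
  by (simp add: keeps_def)

lemma edge_bounds: "(s, t, k) \<in> set (edges b) \<Longrightarrow> s < 13 \<and> t < 13"
  by (cases b) auto

declare edges.simps [simp del]

lemma walk_state_bound: "walk p w q c \<Longrightarrow> p < 13 \<Longrightarrow> q < 13"
  by (induction rule: walk.induct) (auto dest: edge_bounds)

lemma rep_shift: "rep n x S \<Longrightarrow> K \<le> int n \<Longrightarrow> x + int k \<le> K \<longleftrightarrow> (\<exists>c. S c \<and> int (k + c) \<le> K)"
  unfolding rep_def by (drule spec[of _ "K - int k"]) (auto simp: algebra_simps)

lemma rep_add:
  assumes "rep n x S" "rep n y R" "K \<le> int n"
  shows "x + y \<le> K \<longleftrightarrow> (\<exists>c d. S c \<and> R d \<and> int (c + d) \<le> K)"
proof
  assume *: "x + y \<le> K"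
  \<comment> \<open>No cost is at most -1, so the instance \<open>K = -1\<close> of
    \<open>rep\<close> shows that both numbers are nonnegative; neither summand can then exceed
    \<open>n\<close>.\<close>
  have "0 \<le> x" "0 \<le> y"
    using assms(1,2) unfolding rep_def by (auto dest!: spec[of _ "-1"])
  then have "x \<le> int n" "y \<le> int n" using * assms(3) by auto
  then obtain c d where "S c" "int c \<le> x" "R d" "int d \<le> y"
    using assms(1,2) unfolding rep_def by (meson order_refl)
  then show "\<exists>c d. S c \<and> R d \<and> int (c + d) \<le> K" using * by (intro exI[of _ c] exI[of _ d]) auto
next
  assume "\<exists>c d. S c \<and> R d \<and> int (c + d) \<le> K"
  then obtain c d where cd: "S c" "R d" "int (c + d) \<le> K" by blast
  then have "int c \<le> int n" "int d \<le> int n" using assms(3) by auto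
  then have "x \<le> int c" "y \<le> int d" using assms(1,2) cd unfolding rep_def by blast+
  then show "x + y \<le> K" using cd by simp
qed

lemma right:
  assumes n: "length w = n" "i < n" and cursor: "cursor n m i" and X: "m (rec_addr (n - i)) = peg_bit (w ! i)"
    and A: "prefix_ok n m w i"
  shows "cursor n (ev right m) (Suc i)" "prefix_ok n (ev right m) w (Suc i)"
    and "a \<notin> scratch \<Longrightarrow> a \<notin> {-3..-1} \<Longrightarrow> a \<notin> {rec_addr (n - Suc i) - 13..rec_addr (n - Suc i) - 1} \<Longrightarrow>
      ev right m a = m a"
proof -
  define m1 where "m1 = m(rX := peg_bit (w ! i))"
  define m2 where "m2 = ev (vstep (-1) 39 (edges False) (edges True)) m1"
  define m3 where "m3 = m2(rQ := m2 rQ + 40, rPOS := m2 rPOS + 1, rREM := m2 rREM - 1, rT := 1)"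
  note r = rec_shift[OF n(2)] and rec_bound[of "n - Suc i"]
  have Q: "m rQ = rec_addr (n - i)" "m1 rQ = rec_addr (n - i)" using cursor by (auto simp: cursor_def m1_def)
  have ld: "run [Load rX rQ] m = m1" using X Q by (simp add: m1_def)
  have e: "ev right m = m3"
    unfolding right_def ev.simps ld m2_def[symmetric] m3_def by (auto simp: fun_eq_iff)
  have bnd: "\<forall>(s, t, k) \<in> set (edges False) \<union> set (edges True). s < 13 \<and> t < 13"
    using edge_bounds by blast
  have off: "m1 rQ + -1 < -60" "m1 rQ + 39 < -60" using Q r rec_bound[of "n - Suc i"] by auto
  note V = vstep[where m = m1, OF bnd off, folded m2_def]
  have fr: "m2 a = m a" if "a \<notin> scratch" "a \<notin> {rec_addr (n - Suc i) - 13..rec_addr (n - Suc i) - 1}" for a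
    using V(2)[OF that(1)] that(2) Q r that(1) by (auto simp: m1_def scratch_def)
  have regs: "m2 rQ = m rQ" "m2 rPOS = m rPOS" "m2 rREM = m rREM" "m2 rINF = m rINF"
    using rec_bound[of "n - Suc i"] by (auto intro!: fr simp: scratch_def)
  show "cursor n (ev right m) (Suc i)"
    unfolding e m3_def cursor_def using regs cursor r by (auto simp: cursor_def)
  show "ev right m a = m a" if "a \<notin> scratch" "a \<notin> {-3..-1}"
    "a \<notin> {rec_addr (n - Suc i) - 13..rec_addr (n - Suc i) - 1}" for a
    using fr[OF that(1,3)] that(1,2) unfolding e m3_def by (auto simp: scratch_def)
  have tr: "(if m1 rX > 0 then edges True else edges False) = edges (w ! i)"
    by (cases "w ! i") (simp_all add: m1_def peg_bit_def)
  have inf: "m1 rINF = int n + 1" using cursor by (simp add: m1_def cursor_def)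
  have tk: "take (Suc i) w = take i w @ [w ! i]" using n by (simp add: take_Suc_conv_app_nth)
  show "prefix_ok n (ev right m) w (Suc i)"
    unfolding prefix_ok_def rep_def
  proof (intro allI impI)
    fix t K assume t: "t < (13::nat)" and K: "K \<le> int n"
    have a: "rec_addr (n - Suc i) - 1 - int t = m1 rQ + 39 - int t" using Q r by simp
    have "ev right m (rec_addr (n - Suc i) - 1 - int t) = m2 (m1 rQ + 39 - int t)"
      unfolding e m3_def a using off(2) by auto
    then have "ev right m (rec_addr (n - Suc i) - 1 - int t) \<le> K \<longleftrightarrow>
      (\<exists>(s, t', k) \<in> set (edges (w ! i)). t' = t \<and> m1 (m1 rQ + -1 - int s) + int k \<le> K)"
      using V(1)[OF t, of K] K unfolding tr inf by simp
    also have "\<dots> \<longleftrightarrow> (\<exists>(s, t', k) \<in> set (edges (w ! i)). t' = t \<and>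
        (\<exists>c. walk 0 (take i w) s c \<and> int (k + c) \<le> K))"
    proof (rule bex_cong[OF refl], clarify)
      fix s t' k assume st: "(s, t', k) \<in> set (edges (w ! i))"
      then have "s < 13" using edge_bounds by blast
      then have "rep n (m (rec_addr (n - i) - 1 - int s)) (walk 0 (take i w) s)" using A by (simp add: prefix_ok_def)
      moreover have "m1 (m1 rQ + -1 - int s) = m (rec_addr (n - i) - 1 - int s)"
        using Q rec_bound[of "n - i"] by (simp add: m1_def)
      ultimately show "(t' = t \<and> m1 (m1 rQ + -1 - int s) + int k \<le> K) =
         (t' = t \<and> (\<exists>c. walk 0 (take i w) s c \<and> int (k + c) \<le> K))"
        using rep_shift[OF _ K] by metis
    qed
    also have "\<dots> \<longleftrightarrow> (\<exists>c. walk 0 (take (Suc i) w) t c \<and> int c \<le> K)"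
      unfolding tk walk_snoc_iff by blast
    finally show "ev right m (rec_addr (n - Suc i) - 1 - int t) \<le> K \<longleftrightarrow>
      (\<exists>c. walk 0 (take (Suc i) w) t c \<and> int c \<le> K)" .
  qed
qed

lemma left:
  assumes n: "length w = n" "i < n" and cursor: "cursor n m (Suc i)" and X: "m (rec_addr (n - i)) = peg_bit (w ! i)"
    and B: "suffix_ok n m w (Suc i)"
  shows "cursor n (ev left m) i" "suffix_ok n (ev left m) w i"
    and "a \<notin> scratch \<Longrightarrow> a \<notin> {-3..-1} \<Longrightarrow> a \<notin> {rec_addr (n - i) - 32..rec_addr (n - i) - 20} \<Longrightarrow>
      ev left m a = m a"
proof -
  note r = rec_shift[OF n(2)] and rec_bound[of "n - Suc i"]
  define m1 where "m1 = m(rQ := rec_addr (n - i), rT := 40, rX := peg_bit (w ! i))"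
  define m2 where "m2 = ev (vstep 20 (-20) (rev_edges False) (rev_edges True)) m1"
  define m3 where "m3 = m2(rPOS := m2 rPOS - 1, rREM := m2 rREM + 1, rT := 1)"
  have Q: "m rQ = rec_addr (n - Suc i)" "m1 rQ = rec_addr (n - i)" using cursor by (auto simp: cursor_def m1_def)
  have "m rQ - 40 = rec_addr (n - i)" using Q r by simp
  then have ld: "run [Const rT 40, Sub rQ rQ rT, Load rX rQ] m = m1"
    using X r rec_bound[of "n - Suc i"] unfolding m1_def by (auto simp: fun_eq_iff)
  have e: "ev left m = m3"
    unfolding left_def ev.simps ld m2_def[symmetric] m3_def by (auto simp: fun_eq_iff)
  have bnd: "\<forall>(s, t, k) \<in> set (rev_edges False) \<union> set (rev_edges True). s < 13 \<and> t < 13"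
    using edge_bounds unfolding rev_edges_def by fastforce
  have off: "m1 rQ + 20 < -60" "m1 rQ + -20 < -60" using Q r rec_bound[of "n - Suc i"] by auto
  note V = vstep[where m = m1, OF bnd off, folded m2_def]
  have fr: "m2 a = m1 a" if "a \<notin> scratch" "a \<notin> {rec_addr (n - i) - 32..rec_addr (n - i) - 20}" for a
    using V(2)[OF that(1)] that(2) Q r that(1) by auto
  have regs: "m2 rQ = m1 rQ" "m2 rPOS = m1 rPOS" "m2 rREM = m1 rREM" "m2 rINF = m1 rINF"
    using rec_bound[of "n - i"] by (auto intro!: fr simp: scratch_def)
  show "cursor n (ev left m) i"
    unfolding e m3_def cursor_def using regs cursor r by (auto simp: cursor_def m1_def)
  show "ev left m a = m a" if "a \<notin> scratch" "a \<notin> {-3..-1}"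
    "a \<notin> {rec_addr (n - i) - 32..rec_addr (n - i) - 20}" for a
    using fr[OF that(1,3)] that(1,2) unfolding e m3_def m1_def by (auto simp: scratch_def)
  have tr: "(if m1 rX > 0 then rev_edges True else rev_edges False) = rev_edges (w ! i)"
    by (cases "w ! i") (simp_all add: m1_def peg_bit_def)
  have inf: "m1 rINF = int n + 1" using cursor by (simp add: m1_def cursor_def)
  have dr: "drop i w = w ! i # drop (Suc i) w" using n by (simp add: Cons_nth_drop_Suc)
  show "suffix_ok n (ev left m) w i"
    unfolding suffix_ok_def rep_def
  proof (intro allI impI)
    fix t K assume t: "t < (13::nat)" and K: "K \<le> int n"
    have a: "rec_addr (n - i) - 20 - int t = m1 rQ + -20 - int t" using Q r by simp
    have "ev left m (rec_addr (n - i) - 20 - int t) = m2 (m1 rQ + -20 - int t)"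
      unfolding e m3_def a using off(2) by auto
    then have "ev left m (rec_addr (n - i) - 20 - int t) \<le> K \<longleftrightarrow>
      (\<exists>(s, t', k) \<in> set (rev_edges (w ! i)). t' = t \<and> m1 (m1 rQ + 20 - int s) + int k \<le> K)"
      using V(1)[OF t, of K] K unfolding tr inf by simp
    also have "\<dots> \<longleftrightarrow> (\<exists>(s, t', k) \<in> set (rev_edges (w ! i)). t' = t \<and>
        (\<exists>c. walk s (drop (Suc i) w) 0 c \<and> int (k + c) \<le> K))"
    proof (rule bex_cong[OF refl], clarify)
      fix s t' k assume st: "(s, t', k) \<in> set (rev_edges (w ! i))"
      then have "s < 13" using edge_bounds unfolding rev_edges_def by fastforce
      then have "rep n (m (rec_addr (n - Suc i) - 20 - int s)) (walk s (drop (Suc i) w) 0)"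
        using B by (simp add: suffix_ok_def)
      moreover have "m1 (m1 rQ + 20 - int s) = m (rec_addr (n - Suc i) - 20 - int s)"
        using Q r rec_bound[of "n - Suc i"] by (simp add: m1_def)
      ultimately show "(t' = t \<and> m1 (m1 rQ + 20 - int s) + int k \<le> K) =
         (t' = t \<and> (\<exists>c. walk s (drop (Suc i) w) 0 c \<and> int (k + c) \<le> K))"
        using rep_shift[OF _ K] by metis
    qed
    also have "\<dots> \<longleftrightarrow> (\<exists>(t', s, k) \<in> set (edges (w ! i)). t' = t \<and>
        (\<exists>c. walk s (drop (Suc i) w) 0 c \<and> int (k + c) \<le> K))"
      unfolding rev_edges_def set_map bex_simps(7) by (intro bex_cong) auto
    also have "\<dots> \<longleftrightarrow> (\<exists>c. walk t (drop i w) 0 c \<and> int c \<le> K)"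
      unfolding dr walk_Cons_iff by blast
    finally show "ev left m (rec_addr (n - i) - 20 - int t) \<le> K \<longleftrightarrow>
      (\<exists>c. walk t (drop i w) 0 c \<and> int c \<le> K)" .
  qed
qed

lemma prefix_ok_cong:
  "(\<And>s. s < 13 \<Longrightarrow> m' (rec_addr (n - i) - 1 - int s) = m (rec_addr (n - i) - 1 - int s)) \<Longrightarrow>
   take i w' = take i w \<Longrightarrow> prefix_ok n m w i \<Longrightarrow> prefix_ok n m' w' i"
  by (simp add: prefix_ok_def)

lemma suffix_ok_cong:
  "(\<And>s. s < 13 \<Longrightarrow> m' (rec_addr (n - i) - 20 - int s) = m (rec_addr (n - i) - 20 - int s)) \<Longrightarrow>
   drop i w' = drop i w \<Longrightarrow> suffix_ok n m w i \<Longrightarrow> suffix_ok n m' w' i"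
  by (simp add: suffix_ok_def)

lemma right_tape:
  assumes cursor: "cursor n m i" and tape: "tape n m w l (Suc i) b" and i: "i < n" "l \<le> i"
  shows "cursor n (ev right m) (Suc i)" "tape n (ev right m) w l (Suc (Suc i)) b"
    and "keeps m (ev right m)"
proof -
  note R = right[of w n i m, OF _ i(1) cursor]
  have w: "length w = n" "m (rec_addr (n - i)) = peg_bit (w ! i)" "prefix_ok n m w i"
    using tape i by (auto simp: tape_def)
  show "cursor n (ev right m) (Suc i)" by (rule R(1)[OF w])
  note fr = R(3)[OF w]
  show "keeps m (ev right m)"
    unfolding keeps_def using rec_bound[of "n - Suc i"] by (auto intro!: fr simp: scratch_def)
  have "\<forall>k<n. l \<le> k \<longrightarrow> ev right m (rec_addr (n - k)) = peg_bit (w ! k)"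
  proof (intro allI impI)
    fix k assume k: "k < n" "l \<le> k"
    have "rec_addr (n - k) \<notin> {rec_addr (n - Suc i) - 13..rec_addr (n - Suc i) - 1}"
      using rec_offset_between[of "n - k" 0 "n - Suc i" 13 1] by auto
    then have "ev right m (rec_addr (n - k)) = m (rec_addr (n - k))"
      using rec_bound[of "n - k"] by (intro fr) (auto simp: scratch_def)
    then show "ev right m (rec_addr (n - k)) = peg_bit (w ! k)" using tape k by (simp add: tape_def)
  qed
  moreover have "prefix_ok n (ev right m) w k" if "k < Suc (Suc i)" for k
  proof (cases "k = Suc i")
    case False
    then have "k < Suc i" using that by simp
    then have "prefix_ok n m w k" using tape by (simp add: tape_def)
    then show ?thesis
    proof (rule prefix_ok_cong[rotated 2])
      fix s :: nat assume "s < 13"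
      moreover have "n - k \<noteq> n - Suc i" using \<open>k < Suc i\<close> i by simp
      ultimately have "rec_addr (n - k) - 1 - int s \<notin> {rec_addr (n - Suc i) - 13..rec_addr (n - Suc i) - 1}"
        using rec_offset_between[of "n - k" "1 + int s" "n - Suc i" 13 1] by (auto simp: algebra_simps)
      then show "ev right m (rec_addr (n - k) - 1 - int s) = m (rec_addr (n - k) - 1 - int s)"
        using rec_bound[of "n - k"] by (intro fr) (auto simp: scratch_def)
    qed simp
  qed (use R(2)[OF w] in simp)
  moreover have "suffix_ok n (ev right m) w k" if "k \<le> n" "b \<le> k" for k
  proof -
    have "suffix_ok n m w k" using tape that by (simp add: tape_def)
    then show ?thesis
    proof (rule suffix_ok_cong[rotated 2])
      fix s :: nat assume s: "s < 13"
      then have "rec_addr (n - k) - 20 - int s \<notin> {rec_addr (n - Suc i) - 13..rec_addr (n - Suc i) - 1}"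
        using rec_offset_between[of "n - k" "20 + int s" "n - Suc i" 13 1] by (auto simp: algebra_simps)
      then show "ev right m (rec_addr (n - k) - 20 - int s) = m (rec_addr (n - k) - 20 - int s)"
        using rec_bound[of "n - k"] by (intro fr) (auto simp: scratch_def)
    qed simp
  qed
  ultimately show "tape n (ev right m) w l (Suc (Suc i)) b" using w by (simp add: tape_def)
qed

lemma left_tape:
  assumes cursor: "cursor n m (Suc i)" and tape: "tape n m w l a (Suc i)" and i: "i < n" "l \<le> i"
  shows "cursor n (ev left m) i" "tape n (ev left m) w l a i"
    and "keeps m (ev left m)"
proof -
  note R = left[of w n i m, OF _ i(1) cursor]
  have w: "length w = n" "m (rec_addr (n - i)) = peg_bit (w ! i)" "suffix_ok n m w (Suc i)"
    using tape i by (auto simp: tape_def)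
  show "cursor n (ev left m) i" by (rule R(1)[OF w])
  note fr = R(3)[OF w]
  show "keeps m (ev left m)"
    unfolding keeps_def using rec_bound[of "n - i"] by (auto intro!: fr simp: scratch_def)
  have "\<forall>k<n. l \<le> k \<longrightarrow> ev left m (rec_addr (n - k)) = peg_bit (w ! k)"
  proof (intro allI impI)
    fix k assume k: "k < n" "l \<le> k"
    have "rec_addr (n - k) \<notin> {rec_addr (n - i) - 32..rec_addr (n - i) - 20}"
      using rec_offset_between[of "n - k" 0 "n - i" 32 20] by auto
    then have "ev left m (rec_addr (n - k)) = m (rec_addr (n - k))"
      using rec_bound[of "n - k"] by (intro fr) (auto simp: scratch_def)
    then show "ev left m (rec_addr (n - k)) = peg_bit (w ! k)" using tape k by (simp add: tape_def)
  qed
  moreover have "suffix_ok n (ev left m) w k" if "k \<le> n" "i \<le> k" for k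
  proof (cases "k = i")
    case False
    then have "Suc i \<le> k" using that by simp
    then have "suffix_ok n m w k" using tape that by (simp add: tape_def)
    then show ?thesis
    proof (rule suffix_ok_cong[rotated 2])
      fix s :: nat assume "s < 13"
      moreover have "n - k \<noteq> n - i" using \<open>Suc i \<le> k\<close> that i by simp
      ultimately have "rec_addr (n - k) - 20 - int s \<notin> {rec_addr (n - i) - 32..rec_addr (n - i) - 20}"
        using rec_offset_between[of "n - k" "20 + int s" "n - i" 32 20] by (auto simp: algebra_simps)
      then show "ev left m (rec_addr (n - k) - 20 - int s) = m (rec_addr (n - k) - 20 - int s)"
        using rec_bound[of "n - k"] by (intro fr) (auto simp: scratch_def)
    qed simp
  qed (use R(2)[OF w] in simp)
  moreover have "prefix_ok n (ev left m) w k" if "k < a" for k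
  proof -
    have "prefix_ok n m w k" using tape that by (simp add: tape_def)
    then show ?thesis
    proof (rule prefix_ok_cong[rotated 2])
      fix s :: nat assume s: "s < 13"
      then have "rec_addr (n - k) - 1 - int s \<notin> {rec_addr (n - i) - 32..rec_addr (n - i) - 20}"
        using rec_offset_between[of "n - k" "1 + int s" "n - i" 32 20] by (auto simp: algebra_simps)
      then show "ev left m (rec_addr (n - k) - 1 - int s) = m (rec_addr (n - k) - 1 - int s)"
        using rec_bound[of "n - k"] by (intro fr) (auto simp: scratch_def)
    qed simp
  qed
  ultimately show "tape n (ev left m) w l a i" using w by (simp add: tape_def)
qed

text \<open>Every walk is cut at the cursor, where its state is below 13, so the stored entries
  account for all of them.\<close>

lemma dot_tape:
  assumes "cursor n m i" "tape n m w l (Suc i) i" "i \<le> n"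
  shows "rep n (ev dot m rV) (walk 0 w 0)"
  unfolding rep_def
proof (intro allI impI)
  fix K assume K: "K \<le> int n"
  have Q: "m rQ = rec_addr (n - i)" "m rINF = int n + 1" using assms by (auto simp: cursor_def)
  have ab: "prefix_ok n m w i" "suffix_ok n m w i" using assms by (auto simp: tape_def)
  have "ev dot m rV \<le> K \<longleftrightarrow>
    (\<exists>s<13. m (rec_addr (n - i) - 1 - int s) + m (rec_addr (n - i) - 20 - int s) \<le> K)"
    using ev_dot(1)[of m K] Q K rec_bound[of "n - i"] by simp
  also have "\<dots> \<longleftrightarrow> (\<exists>s<13. \<exists>c d. walk 0 (take i w) s c \<and> walk s (drop i w) 0 d \<and> int (c + d) \<le> K)"
    using rep_add[OF _ _ K] ab unfolding prefix_ok_def suffix_ok_def by (intro ex_cong1 conj_cong refl) blast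
  also have "\<dots> \<longleftrightarrow> (\<exists>c. walk 0 (take i w @ drop i w) 0 c \<and> int c \<le> K)"
  proof -
    have "walk 0 (take i w) s c \<Longrightarrow> s < 13" for s c by (rule walk_state_bound) auto
    then show ?thesis unfolding walk_append_iff by blast
  qed
  finally show "ev dot m rV \<le> K \<longleftrightarrow> (\<exists>c. walk 0 w 0 c \<and> int c \<le> K)" by simp
qed

section \<open>Greedy hopping\<close>

lemma hop_at_update_iff:
  "hop_at i d w v \<longleftrightarrow> i + 2 < length w \<and> w ! i = (\<not> d) \<and> w ! (i + 1) \<and> w ! (i + 2) = d \<and>
     v = w[i := d, i + 1 := False, i + 2 := \<not> d]"
  by (auto simp: hop_at_def)

text \<open>In use, \<open>g\<close> is the cost of the initial word. Hops never lower the cost, so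
  a hop whose result has cost at most \<open>g\<close> preserves the cost.\<close>

definition stuck :: "nat \<Rightarrow> bool list \<Rightarrow> nat \<Rightarrow> bool" where
  "stuck g w j \<longleftrightarrow> (\<forall>d v. hop_at j d w v \<longrightarrow> \<not> cost_le v g)"

text \<open>Hops at disjoint windows commute, so performing one of them cannot make the other one
  cost-preserving.\<close>
lemma stuck_hop:
  assumes "stuck g w j" "hop_at i d w w'" "j + 2 < i"
  shows "stuck g w' j"
  unfolding stuck_def
proof (intro allI impI notI)
  fix e v' assume h: "hop_at j e w' v'" and s: "cost_le v' g"
  define v where "v = w[j := e, j + 1 := False, j + 2 := \<not> e]"
  have v: "hop_at j e w v"
    using h assms(2,3) unfolding hop_at_update_iff v_def by auto
  have "v' = v[i := d, i + 1 := False, i + 2 := \<not> d]"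
    using h assms(2,3) unfolding hop_at_update_iff v_def by (simp add: list_update_swap)
  then have "hop_at i d v v'"
    using assms(2,3) unfolding hop_at_update_iff v_def by auto
  with s have "cost_le v g" by (rule cost_le_unhop[rotated])
  with v assms(1) show False by (simp add: stuck_def)
qed

text \<open>Otherwise \<open>hoppable_or_ones\<close> would supply a hop of cost at most
  \<open>g\<close> in one of the stuck windows.\<close>

lemma stuck_imp_optimal:
  assumes "cost_le w g" "\<And>j. j + 2 < length w \<Longrightarrow> stuck g w j"
  shows "pegs w \<le> g \<or> False \<notin> set w"
proof (rule ccontr)
  assume *: "\<not> ?thesis"
  obtain c where c: "walk 0 w 0 c" "c \<le> g" using assms(1) by (auto simp: cost_le_def)
  have "w \<noteq> replicate (length w) True" using * by (metis in_set_replicate)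
  with hoppable_or_ones[OF c(1)] c * have "hoppable 0 w c" by auto
  then obtain i d v c' where "hop_at i d w v" "walk 0 v 0 c'" "c' \<le> c" by (auto simp: hoppable_def)
  moreover from this have "i + 2 < length w" by (simp add: hop_at_def)
  ultimately show False using assms(2) c(2) unfolding stuck_def cost_le_def by (meson le_trans)
qed

section \<open>Hop sequences and reachable words\<close>

lemma hop_seq_snoc: "hop_seq (hs @ [h]) w v \<longleftrightarrow> (\<exists>u. hop_seq hs w u \<and> hop_at (fst h) (snd h) u v)"
  by (induction hs arbitrary: w) auto

lemma hop_seq_reachable: "hop_seq hs w v \<Longrightarrow> reachable w v"
proof (induction hs arbitrary: w)
  case (Cons h hs)
  then obtain u where "hop w u" "reachable u v" by (auto simp: hop_def)
  then show ?case unfolding reachable_def by (rule converse_rtranclp_into_rtranclp)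
qed (simp add: reachable_def)

lemma hop_holes: "hop w v \<Longrightarrow> False \<in> set w \<and> False \<in> set v"
  unfolding hop_def hop_at_iff by (elim exE conjE) simp

lemma reachable_cost_le: "reachable w v \<Longrightarrow> cost_le v c \<Longrightarrow> cost_le w c"
  unfolding reachable_def
proof (induction rule: converse_rtranclp_induct)
  case (step w u)
  then show ?case unfolding hop_def using cost_le_unhop by blast
qed

text \<open>A hop both requires and leaves a hole, so a full word is connected by hops only with
  itself. This settles the filled board, where the number of pegs may exceed the cost.\<close>

lemma no_hole_minimal:
  assumes "reachable w w'" "False \<notin> set w'" "reachable w v"
  shows "v = w'"
proof -
  have "w = w'"
    using assms(1) unfolding reachable_def
    by (cases rule: rtranclp.cases) (use assms(2) hop_holes in auto)
  from assms(3) show ?thesis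
    unfolding reachable_def
    by (cases rule: converse_rtranclpE) (use assms(2) \<open>w = w'\<close> hop_holes in auto)
qed

section \<open>Register code of one greedy step\<close>

lemma rec_offset_eq: "rec_addr r - x = rec_addr r' \<Longrightarrow> 0 \<le> x \<Longrightarrow> x < 40 \<Longrightarrow> r = r' \<and> x = 0"
  using rec_offset_between[of r x r' 0 0] by auto

lemma rec_eq_iff: "rec_addr r = rec_addr r' \<longleftrightarrow> r = r'"
  by (simp add: rec_addr_def)

lemma tape_cong:
  assumes "\<And>a. a \<le> -100 \<Longrightarrow> m' a = m a" "tape n m w l a b"
  shows "tape n m' w l a b"
proof -
  have "m' (rec_addr r - x) = m (rec_addr r - x)" if "0 \<le> x" for r x
    using that rec_bound[of r] by (intro assms(1)) simp
  from this[of 0] this[of "1 + int s" for s] this[of "20 + int s" for s] show ?thesis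
    using assms(2) unfolding tape_def prefix_ok_def suffix_ok_def by (simp add: algebra_simps)
qed

lemma tape_weaken:
  "tape n m w l a b \<Longrightarrow> l \<le> l' \<Longrightarrow> a' \<le> a \<Longrightarrow> b \<le> b' \<Longrightarrow> tape n m w l' a' b'"
  by (simp add: tape_def)

definition write3 :: "int \<Rightarrow> int \<Rightarrow> int \<Rightarrow> instr list" where
  "write3 r1 r2 r3 = [Store rQ r1, Const rT 40, Add rT rQ rT, Store rT r2,
     Const rT 80, Add rT rQ rT, Store rT r3]"

text \<open>Letters at \<open>i\<close> to \<open>i + 2\<close> affect the prefix costs after
  position \<open>i\<close> and the suffix costs before \<open>i + 3\<close>; the \<open>min\<close>
  and \<open>max\<close> withdraw the validity of exactly those.\<close>

lemma write3_tape:
  assumes cursor: "cursor n m i" and tape: "tape n m (u @ [x1, x2, x3] @ z) 0 a b" and u: "length u = i"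
    and r: "{r1, r2, r3} \<subseteq> {-15..-7}" and y: "m r1 = peg_bit y1" "m r2 = peg_bit y2" "m r3 = peg_bit y3"
  shows "cursor n (run (write3 r1 r2 r3) m) i"
    and "tape n (run (write3 r1 r2 r3) m) (u @ [y1, y2, y3] @ z) 0 (min a (Suc i)) (max b (i + 3))"
    and "keeps m (run (write3 r1 r2 r3) m)"
proof -
  define m' where "m' = run (write3 r1 r2 r3) m"
  let ?w = "u @ [x1, x2, x3] @ z" and ?w' = "u @ [y1, y2, y3] @ z"
  have n: "n = i + 3 + length z" using tape u by (simp add: tape_def)
  have r1: "rec_addr (n - i) + 40 = rec_addr (n - Suc i)" "rec_addr (n - i) + 80 = rec_addr (n - Suc (Suc i))"
    using n by (simp_all add: rec_addr_def)
  have bnd: "rec_addr (n - i) \<le> -100" "rec_addr (n - Suc i) \<le> -100" "rec_addr (n - Suc (Suc i)) \<le> -100"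
    by (rule rec_bound)+
  have Q: "m rQ = rec_addr (n - i)" using cursor by (simp add: cursor_def)
  have e: "m' = m(rT := rec_addr (n - Suc (Suc i)), rec_addr (n - i) := peg_bit y1, rec_addr (n - Suc i) := peg_bit y2,
      rec_addr (n - Suc (Suc i)) := peg_bit y3)"
    using r bnd Q y unfolding m'_def write3_def by (auto simp: fun_eq_iff r1)
  show "cursor n (run (write3 r1 r2 r3) m) i"
    unfolding m'_def[symmetric] e using cursor bnd by (auto simp: cursor_def)
  show "keeps m (run (write3 r1 r2 r3) m)"
    unfolding m'_def[symmetric] e keeps_def using bnd by auto
  have off: "m' (rec_addr r - x) = m (rec_addr r - x)" if "0 < x" "x < 40" for r x
    using rec_offset_eq[of r x] that rec_bound[of r] unfolding e by auto
  have "m' (rec_addr (n - k)) = peg_bit (?w' ! k)" if k: "k < n" for k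
  proof -
    consider "k = i" | "k = Suc i" | "k = Suc (Suc i)" | "k \<notin> {i, Suc i, Suc (Suc i)}" by auto
    then show ?thesis
    proof cases
      case 4
      then have "?w' ! k = ?w ! k" using u by (auto simp: nth_append nth_Cons split: nat.splits)
      moreover have "m' (rec_addr (n - k)) = m (rec_addr (n - k))"
        using 4 n k rec_bound[of "n - k"] unfolding e by (auto simp: rec_eq_iff)
      ultimately show ?thesis using tape k by (simp add: tape_def)
    qed (use u n in \<open>auto simp: e rec_eq_iff nth_append\<close>)
  qed
  moreover have "prefix_ok n m' ?w' k" if "k < min a (Suc i)" for k
  proof (rule prefix_ok_cong)
    show "prefix_ok n m ?w k" using tape that by (simp add: tape_def)
    show "take k ?w' = take k ?w" using that u by simp
    show "m' (rec_addr (n - k) - 1 - int s) = m (rec_addr (n - k) - 1 - int s)" if "s < 13" for s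
      using off[of "1 + int s" "n - k"] that by (simp add: algebra_simps)
  qed
  moreover have "suffix_ok n m' ?w' k" if "k \<le> n" "max b (i + 3) \<le> k" for k
  proof (rule suffix_ok_cong)
    show "suffix_ok n m ?w k" using tape that by (simp add: tape_def)
    have "drop k ((u @ [p, q, r]) @ z) = drop (k - (i + 3)) z" for p q r
      using that u drop_append[of k "u @ [p, q, r]" z] drop_all[of "u @ [p, q, r]" k]
      by (simp add: numeral_3_eq_3)
    then show "drop k ?w' = drop k ?w" by simp
    show "m' (rec_addr (n - k) - 20 - int s) = m (rec_addr (n - k) - 20 - int s)" if "s < 13" for s
      using off[of "20 + int s" "n - k"] that by (simp add: algebra_simps)
  qed
  moreover have "length ?w' = n" using n u by simp
  ultimately show "tape n (run (write3 r1 r2 r3) m) ?w' 0 (min a (Suc i)) (max b (i + 3))"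
    unfolding m'_def[symmetric] tape_def by simp
qed

text \<open>At the left border the cursor stays, in agreement with the truncated
  \<open>i - 1\<close> of \<open>back_up_tape\<close>.\<close>

definition back_up :: com where "back_up = IfPos rPOS left (Block [])"

lemma back_up_tape:
  assumes "cursor n m i" "tape n m w 0 a i" "i \<le> n"
  shows "cursor n (ev back_up m) (i - 1) \<and> tape n (ev back_up m) w 0 a (i - 1) \<and> keeps m (ev back_up m)"
proof (cases i)
  case 0
  then show ?thesis using assms by (simp add: back_up_def cursor_def keeps_def)
next
  case (Suc j)
  then show ?thesis using assms left_tape[of n m j w 0 a] by (simp add: back_up_def cursor_def)
qed

definition read3 :: "instr list" where
  "read3 = [Load rX1 rQ, Const rT 40, Add rT rQ rT, Load rX2 rT, Const rT 80, Add rT rQ rT, Load rX3 rT]"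

text \<open>A window admits a hop iff its middle letter is a peg and its outer letters
  differ.\<close>

definition set_flag :: com where
  "set_flag = Block [Const rF 0] ;;
     IfPos rX2 (IfPos rX1 (IfPos rX3 (Block []) (Block [Const rF 1]))
                          (IfPos rX3 (Block [Const rF 1]) (Block []))) (Block [])"

text \<open>In a hoppable window the right letter equals the direction bit, so \<open>rX3\<close>
  completes the code of the hop. The left moves bring the suffix costs up to date with the new
  letters.\<close>

definition accept :: com where
  "accept = left ;; left ;; left ;;
     Block [Const rT 1, Add rOUT rOUT rT, Add rT rPOS rPOS, Add rT rT rX3, Store rOUT rT] ;;
     back_up ;; back_up"

text \<open>The pointer is first moved by arithmetic (\<open>120 = 3 * 40\<close>), because
  \<open>left\<close> would compute suffix costs from the trial letters. After the letters are
  restored, the left moves re-establish the suffix costs, and \<open>right\<close> passes the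
  window.\<close>

definition reject :: com where
  "reject = Block ([Const rT 120, Sub rQ rQ rT, Const rT 3, Sub rPOS rPOS rT, Add rREM rREM rT] @
       write3 rX1 rX2 rX3 @
       [Const rT 120, Add rQ rQ rT, Const rT 3, Add rPOS rPOS rT, Sub rREM rREM rT]) ;;
     left ;; left ;; left ;; right"

text \<open>A hop swaps the differing outer letters and clears the middle one; \<open>rF\<close>
  supplies the hole. The cost is queried at \<open>i + 3\<close>, where the suffix does not see the
  window and three right moves have made the prefix costs current.\<close>

definition try_hop :: com where
  "try_hop = Block (Const rF 0 # write3 rX3 rF rX1) ;; right ;; right ;; right ;; dot ;;
     Block [Sub rV rV rG] ;; IfPos rV reject accept"

text \<open>The final \<open>rC\<close> is positive iff a whole window remains at the
  cursor.\<close>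

definition body :: com where
  "body = Block read3 ;; set_flag ;; IfPos rF try_hop right ;; Block [Const rT 2, Sub rC rREM rT]"

definition hop_code :: "nat \<times> bool \<Rightarrow> int" where
  "hop_code h = 2 * int (fst h) + peg_bit (snd h)"

definition outputs :: "mem \<Rightarrow> (nat \<times> bool) list \<Rightarrow> bool" where
  "outputs m hs \<longleftrightarrow> m rOUT = int (length hs) \<and> (\<forall>j < length hs. m (int j + 1) = hop_code (hs ! j))"

lemma outputs_keeps: "keeps m m' \<Longrightarrow> outputs m hs \<Longrightarrow> outputs m' hs"
  by (simp add: outputs_def keeps_def)

text \<open>Prefix costs beyond the cursor and suffix costs before it may stem from earlier words;
  the moves recompute them on the way.\<close>

definition greedy_inv :: "bool list \<Rightarrow> nat \<Rightarrow> bool list \<Rightarrow> nat \<Rightarrow> (nat \<times> bool) list \<Rightarrow> mem \<Rightarrow> bool" where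
  "greedy_inv w0 g w i hs m \<longleftrightarrow> (let n = length w0 in
     i \<le> n \<and> cursor n m i \<and> tape n m w 0 (Suc i) i \<and> m rG = int g \<and> outputs m hs \<and>
     hop_seq hs w0 w \<and> cost_le w g \<and> (\<forall>j<i. stuck g w j))"

lemma left3:
  assumes "cursor n m (i + 3)" "tape n m w 0 a (i + 3)" "i + 3 \<le> n"
  defines "m' \<equiv> ev left (ev left (ev left m))"
  shows "cursor n m' i" "tape n m' w 0 a i" "keeps m m'"
proof -
  define m1 where "m1 = ev left m"
  define m2 where "m2 = ev left m1"
  have m': "m' = ev left m2" by (simp add: m'_def m1_def m2_def)
  have 1: "cursor n m1 (i + 2)" "tape n m1 w 0 a (i + 2)" "keeps m m1"
    using left_tape[of n m "i + 2" w 0 a] assms(1-3) unfolding m1_def by (simp_all add: eval_nat_numeral)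
  have 2: "cursor n m2 (i + 1)" "tape n m2 w 0 a (i + 1)" "keeps m1 m2"
    using left_tape[of n m1 "i + 1" w 0 a] 1 assms(3) unfolding m2_def by (simp_all add: eval_nat_numeral)
  have 3: "cursor n m' i" "tape n m' w 0 a i" "keeps m2 m'"
    using left_tape[of n m2 i w 0 a] 2 assms(3) unfolding m' by simp_all
  then show "cursor n m' i" "tape n m' w 0 a i" "keeps m m'" using 1 2 keeps_trans by blast+
qed

lemma accept:
  assumes m: "cursor n m (i + 3)" "tape n m w' 0 (i + 4) (i + 3)" "i + 3 \<le> n" "m rG = int g"
      "outputs m hs" "m rX3 = peg_bit d"
    and h: "hop_seq hs w0 w" "hop_at i d w w'" "cost_le w' g" "length w0 = n" and st: "\<forall>j<i. stuck g w j"
  shows "greedy_inv w0 g w' (i - 2) (hs @ [(i, d)]) (ev accept m)"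
proof -
  define m3 where "m3 = ev left (ev left (ev left m))"
  define m4 where "m4 = run [Const rT 1, Add rOUT rOUT rT, Add rT rPOS rPOS, Add rT rT rX3, Store rOUT rT] m3"
  define m5 where "m5 = ev back_up m4"
  define m6 where "m6 = ev back_up m5"
  have e: "ev accept m = m6"
    unfolding accept_def ev.simps m3_def[symmetric] m4_def[symmetric] m5_def[symmetric] m6_def[symmetric] ..
  note 3 = left3[OF m(1-3), folded m3_def]
  note k = 3(3)
  from k have r: "m3 rG = int g" "m3 rX3 = peg_bit d" "m3 rOUT = int (length hs)" "outputs m3 hs"
    using m outputs_keeps[OF k] by (auto simp: keeps_def outputs_def)
  have pos: "m3 rPOS = int i" using 3 by (simp add: cursor_def)
  have e4: "m4 = m3(rT := 2 * int i + peg_bit d, rOUT := int (length hs) + 1, int (length hs) + 1 := 2 * int i + peg_bit d)"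
    unfolding m4_def using r pos by (auto simp: fun_eq_iff)
  have c4: "cursor n m4 i" using 3 unfolding e4 cursor_def by auto
  have t4: "tape n m4 w' 0 (i + 4) i"
    by (rule tape_cong[OF _ 3(2)]) (auto simp: e4)
  have o4: "outputs m4 (hs @ [(i, d)])" and g4: "m4 rG = int g"
    using r unfolding e4 by (auto simp: outputs_def nth_append hop_code_def less_Suc_eq)
  have 5: "cursor n m5 (i - 1)" "tape n m5 w' 0 (i + 4) (i - 1)" "keeps m4 m5"
    using back_up_tape[OF c4 t4] m unfolding m5_def by auto
  have 6: "cursor n m6 (i - 1 - 1)" "tape n m6 w' 0 (i + 4) (i - 1 - 1)" "keeps m5 m6"
    using back_up_tape[OF 5(1,2)] m unfolding m6_def by auto
  have i2: "i - 1 - 1 = i - 2" by simp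
  have k6: "keeps m4 m6" using 5 6 keeps_trans by blast
  have "tape n m6 w' 0 (Suc (i - 2)) (i - 2)"
    using 6(2) unfolding i2 by (rule tape_weaken) auto
  moreover have "outputs m6 (hs @ [(i, d)])" "m6 rG = int g"
    using outputs_keeps[OF k6 o4] k6 g4 by (auto simp: keeps_def)
  \<comment> \<open>Windows \<open>i - 2\<close> and \<open>i - 1\<close> overlap the hop and may
    have become usable, which is why the cursor goes back by two.\<close>
  moreover have "stuck g w' j" if "j < i - 2" for j
    using st stuck_hop[OF _ h(2)] that by auto
  ultimately show ?thesis
    unfolding greedy_inv_def Let_def e using h 6(1) i2 m(3) by (auto simp: hop_seq_snoc)
qed

lemma right3_dot:
  assumes "cursor n m i" "tape n m w 0 (Suc i) (i + 3)" "i + 3 \<le> n"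
  defines "m' \<equiv> ev dot (ev right (ev right (ev right m)))"
  shows "cursor n m' (i + 3)" "tape n m' w 0 (i + 4) (i + 3)" "keeps m m'" "rep n (m' rV) (walk 0 w 0)"
proof -
  define m1 where "m1 = ev right m"
  define m2 where "m2 = ev right m1"
  define m3 where "m3 = ev right m2"
  have 1: "cursor n m1 (Suc i)" "tape n m1 w 0 (Suc (Suc i)) (i + 3)" "keeps m m1"
    using right_tape[OF assms(1,2)] assms(3) unfolding m1_def by auto
  have 2: "cursor n m2 (Suc (Suc i))" "tape n m2 w 0 (Suc (Suc (Suc i))) (i + 3)" "keeps m1 m2"
    using right_tape[OF 1(1,2)] assms(3) unfolding m2_def by auto
  have 3: "cursor n m3 (i + 3)" "tape n m3 w 0 (i + 4) (i + 3)" "keeps m2 m3"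
    using right_tape[OF 2(1,2)] assms(3) unfolding m3_def by (auto simp: eval_nat_numeral)
  have Q: "m3 rQ < -60" using 3(1) rec_bound[of "n - (i + 3)"] by (simp add: cursor_def)
  have fr: "\<And>a. a \<notin> scratch \<Longrightarrow> m' a = m3 a"
    using ev_dot(2)[of m3, OF Q] unfolding m'_def m1_def m2_def m3_def by blast
  show "cursor n m' (i + 3)" using 3(1) fr by (simp add: cursor_def scratch_def)
  show "tape n m' w 0 (i + 4) (i + 3)"
    by (rule tape_cong[OF _ 3(2)]) (auto intro!: fr simp: scratch_def)
  have "keeps m3 m'" unfolding keeps_def by (auto intro!: fr simp: scratch_def)
  then show "keeps m m'" using 1 2 3 keeps_trans by blast
  have "tape n m3 w 0 (Suc (i + 3)) (i + 3)" using 3(2) by (simp add: eval_nat_numeral)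
  from dot_tape[OF 3(1) this assms(3)] show "rep n (m' rV) (walk 0 w 0)"
    unfolding m'_def m1_def m2_def m3_def .
qed

lemma rep_cost_le: "rep n x (walk 0 w 0) \<Longrightarrow> g \<le> n \<Longrightarrow> x \<le> int g \<longleftrightarrow> cost_le w g"
  by (auto simp: rep_def cost_le_def)


text \<open>A right move lowers \<open>n - i\<close> by one. An accepted hop raises it by at most
  two but removes a peg, so weight 3 on the pegs makes the potential drop in every round.\<close>

lemma body_greedy:
  assumes inv: "greedy_inv w0 g w i hs m" and i: "i + 2 < length w0" and g: "g \<le> length w0"
  shows "\<exists>w' i' hs'. greedy_inv w0 g w' i' hs' (ev body m) \<and>
    (length w0 - i') + 3 * pegs w' < (length w0 - i) + 3 * pegs w \<and>
    ev body m rC = int (length w0) - int i' - 2"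
proof -
  define n where "n = length w0"
  have n: "i + 2 < n" "g \<le> n" using i g by (simp_all add: n_def)
  have m: "cursor n m i" "tape n m w 0 (Suc i) i" "m rG = int g" "outputs m hs"
    and h: "hop_seq hs w0 w" "cost_le w g" and st: "\<forall>j<i. stuck g w j"
    using inv by (auto simp: greedy_inv_def Let_def n_def)
  have lw: "length w = n" using m(2) by (simp add: tape_def)
  define x1 x2 x3 where "x1 = w ! i" and "x2 = w ! (i + 1)" and "x3 = w ! (i + 2)"
  define u z where "u = take i w" and "z = drop (i + 3) w"
  have w: "w = u @ [x1, x2, x3] @ z" and u: "length u = i"
    using list_window[of i w] n lw by (simp_all add: x1_def x2_def x3_def u_def z_def)
  have r: "rec_addr (n - i) + 40 = rec_addr (n - Suc i)" "rec_addr (n - i) + 80 = rec_addr (n - Suc (Suc i))"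
    using n by (simp_all add: rec_addr_def of_nat_diff)
  have bnd: "rec_addr (n - i) \<le> -100" "rec_addr (n - Suc i) \<le> -100" "rec_addr (n - Suc (Suc i)) \<le> -100"
    by (rule rec_bound)+
  have Q: "m rQ = rec_addr (n - i)" using m by (simp add: cursor_def)
  have ltr: "m (rec_addr (n - i)) = peg_bit x1" "m (rec_addr (n - Suc i)) = peg_bit x2" "m (rec_addr (n - Suc (Suc i))) = peg_bit x3"
    using m(2) n unfolding tape_def x1_def x2_def x3_def by auto
  have hop: "hop_at i d w v \<longleftrightarrow> x2 \<and> x1 = (\<not> d) \<and> x3 = d \<and> v = u @ [d, False, \<not> d] @ z" for d v
    unfolding hop_at_iff w using u by auto
  define F where "F = (x2 \<and> x1 \<noteq> x3)"
  define m1 where "m1 = m(rT := rec_addr (n - Suc (Suc i)), rX1 := peg_bit x1, rX2 := peg_bit x2, rX3 := peg_bit x3, rF := peg_bit F)"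
  have read: "run read3 m = m(rT := rec_addr (n - Suc (Suc i)), rX1 := peg_bit x1, rX2 := peg_bit x2, rX3 := peg_bit x3)"
    using Q bnd ltr unfolding read3_def by (auto simp: fun_eq_iff r)
  have m1: "ev set_flag (run read3 m) = m1"
    unfolding read set_flag_def m1_def F_def by (auto simp: fun_eq_iff peg_bit_def)
  have c1: "cursor n m1 i" using m(1) by (simp add: cursor_def m1_def)
  have t1: "tape n m1 w 0 (Suc i) i" by (rule tape_cong[OF _ m(2)]) (auto simp: m1_def)
  have o1: "outputs m1 hs" "m1 rG = int g" using m by (auto simp: m1_def outputs_def)
  have X1: "m1 rX1 = peg_bit x1" "m1 rX2 = peg_bit x2" "m1 rX3 = peg_bit x3" by (auto simp: m1_def)
  define m2 where "m2 = ev (IfPos rF try_hop right) m1"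
  have "m1 rF > 0 \<longleftrightarrow> F" by (simp add: m1_def peg_bit_def)
  then have m2_if: "m2 = (if F then ev try_hop m1 else ev right m1)" by (simp add: m2_def)
  have eb: "ev body m = m2(rC := m2 rREM - 2, rT := 2)"
    unfolding body_def ev.simps(1,2) m1 m2_def[symmetric] by (auto simp: fun_eq_iff)
  have fin: "\<exists>w' i' hs'. greedy_inv w0 g w' i' hs' (ev body m) \<and>
    (length w0 - i') + 3 * pegs w' < (length w0 - i) + 3 * pegs w \<and>
    ev body m rC = int (length w0) - int i' - 2"
    if inv2: "greedy_inv w0 g w' i' hs' m2"
      and dec: "(length w0 - i') + 3 * pegs w' < (length w0 - i) + 3 * pegs w" for w' i' hs'
  proof -
    have "cursor n m2 i'" "tape n m2 w' 0 (Suc i') i'" "outputs m2 hs'" "m2 rG = int g"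
      using inv2 by (auto simp: greedy_inv_def Let_def n_def)
    then have "cursor n (ev body m) i'" "outputs (ev body m) hs'" "ev body m rG = int g"
        "ev body m rC = int n - int i' - 2"
      unfolding eb by (auto simp: cursor_def outputs_def)
    moreover have "tape n (ev body m) w' 0 (Suc i') i'"
      by (rule tape_cong[OF _ \<open>tape n m2 w' 0 (Suc i') i'\<close>]) (auto simp: eb)
    ultimately have "greedy_inv w0 g w' i' hs' (ev body m)"
      using inv2 by (simp add: greedy_inv_def Let_def n_def)
    then show ?thesis using dec \<open>ev body m rC = _\<close> by (auto simp: n_def)
  qed
  \<comment> \<open>Used both for a window without a hop and for one whose trial hop was
    rejected.\<close>
  have move: "greedy_inv w0 g w (Suc i) hs (ev right m')"
    if "cursor n m' i" "tape n m' w 0 (Suc i) i" "outputs m' hs" "m' rG = int g" "stuck g w i" for m'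
  proof -
    note R = right_tape[OF that(1,2)]
    have "keeps m' (ev right m')" using R n by simp
    then have "outputs (ev right m') hs" "ev right m' rG = int g"
      using that outputs_keeps by (auto simp: keeps_def)
    moreover have "tape n (ev right m') w 0 (Suc (Suc i)) (Suc i)"
      by (rule tape_weaken[OF R(2)]) (use n in auto)
    moreover have "\<forall>j<Suc i. stuck g w j" using st that(5) less_Suc_eq by auto
    ultimately show ?thesis using R(1) n h by (simp add: greedy_inv_def Let_def n_def)
  qed
  show ?thesis
  proof (cases F)
    case False
    have "stuck g w i" unfolding stuck_def hop using False by (auto simp: F_def)
    from move[OF c1 t1 o1 this] have "greedy_inv w0 g w (Suc i) hs m2"
      using False by (simp add: m2_if)
    then show ?thesis by (rule fin) (use i in simp)
  next
    case True
    define w' where "w' = u @ [x3, False, x1] @ z"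
    define m3 where "m3 = run (Const rF 0 # write3 rX3 rF rX1) m1"
    have x: "x2" "x1 = (\<not> x3)" using True by (auto simp: F_def)
    have h1: "hop_at i x3 w w'" unfolding hop w'_def using x by simp
    have m1F: "cursor n (m1(rF := 0)) i" "tape n (m1(rF := 0)) (u @ [x1, x2, x3] @ z) 0 (Suc i) i"
      "keeps m1 (m1(rF := 0))"
      using c1 tape_cong[OF _ t1, of "m1(rF := 0)"] unfolding w by (auto simp: cursor_def keeps_def)
    have m3_eq: "m3 = run (write3 rX3 rF rX1) (m1(rF := 0))" by (simp add: m3_def)
    have W: "cursor n m3 i" "tape n m3 w' 0 (Suc i) (i + 3)" "keeps (m1(rF := 0)) m3"
      using write3_tape[OF m1F(1,2) u, of rX3 rF rX1 x3 False x1] X1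
      unfolding m3_eq w'_def by (auto simp: peg_bit_def max_def)
    define m4 where "m4 = ev dot (ev right (ev right (ev right m3)))"
    have i3: "i + 3 \<le> n" using n by simp
    note D = right3_dot[OF W(1,2) i3, folded m4_def]
    define m5 where "m5 = m4(rV := m4 rV - m4 rG)"
    have k: "keeps m1 m4" using m1F(3) W(3) D(3) keeps_trans by blast
    have r4: "m4 rG = int g" "m4 rX1 = peg_bit x1" "m4 rX2 = peg_bit x2" "m4 rX3 = peg_bit x3" "outputs m4 hs"
      using k o1 X1 outputs_keeps[OF k] by (auto simp: keeps_def)
    have V: "m5 rV > 0 \<longleftrightarrow> \<not> cost_le w' g"
      using rep_cost_le[OF D(4) n(2)] r4 by (auto simp: m5_def)
    have c5: "cursor n m5 (i + 3)" using D(1) by (simp add: cursor_def m5_def)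
    have t5: "tape n m5 w' 0 (i + 4) (i + 3)" by (rule tape_cong[OF _ D(2)]) (auto simp: m5_def)
    have r5: "m5 rG = int g" "m5 rX1 = peg_bit x1" "m5 rX2 = peg_bit x2" "m5 rX3 = peg_bit x3" "outputs m5 hs"
      using r4 by (auto simp: m5_def outputs_def)
    have m2: "m2 = (if m5 rV > 0 then ev reject m5 else ev accept m5)"
      unfolding m2_if try_hop_def ev.simps m3_def[symmetric] m4_def[symmetric]
      using True by (simp add: m5_def)
    show ?thesis
    proof (cases "cost_le w' g")
      case True
      have "greedy_inv w0 g w' (i - 2) (hs @ [(i, x3)]) m2"
        using accept[OF c5 t5 i3 r5(1,5,4) h(1) h1 True _ st] V True unfolding m2 by (simp add: n_def)
      then show ?thesis
        by (rule fin) (use pegs_hop[OF h1] i in auto)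
    next
      case False
      define m6 where "m6 = m5(rQ := rec_addr (n - i), rPOS := int i, rREM := int n - int i, rT := 3)"
      have "m5 rQ - 120 = rec_addr (n - i)" using c5 i3 by (simp add: cursor_def rec_addr_def of_nat_diff)
      then have rewind: "run [Const rT 120, Sub rQ rQ rT, Const rT 3, Sub rPOS rPOS rT, Add rREM rREM rT] m5 = m6"
        using c5 unfolding m6_def by (auto simp: fun_eq_iff cursor_def)
      have c6: "cursor n m6 i" using c5 by (simp add: m6_def cursor_def)
      have "tape n m6 w' 0 (i + 4) (i + 3)" by (rule tape_cong[OF _ t5]) (auto simp: m6_def)
      moreover have "i + 4 > i" by simp
      ultimately have t6: "tape n m6 (u @ [x3, False, x1] @ z) 0 (Suc i) (i + 3)"
        unfolding w'_def by (elim tape_weaken) auto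
      have r6: "m6 rX1 = peg_bit x1" "m6 rX2 = peg_bit x2" "m6 rX3 = peg_bit x3" "outputs m6 hs" "m6 rG = int g"
        using r5 by (auto simp: m6_def outputs_def)
      define m7 where "m7 = run (write3 rX1 rX2 rX3) m6"
      have W7: "cursor n m7 i" "tape n m7 w 0 (Suc i) (i + 3)" "keeps m6 m7"
        using write3_tape[OF c6 t6 u, of rX1 rX2 rX3 x1 x2 x3] r6 unfolding m7_def w by auto
      define m8 where "m8 = m7(rQ := rec_addr (n - (i + 3)), rPOS := int (i + 3), rREM := int n - int (i + 3), rT := 3)"
      have "m7 rQ + 120 = rec_addr (n - (i + 3))" using W7(1) i3 by (simp add: cursor_def rec_addr_def of_nat_diff)
      then have forward: "run [Const rT 120, Add rQ rQ rT, Const rT 3, Add rPOS rPOS rT, Sub rREM rREM rT] m7 = m8"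
        using W7(1) unfolding m8_def by (auto simp: fun_eq_iff cursor_def)
      have c8: "cursor n m8 (i + 3)" using W7(1) by (simp add: m8_def cursor_def)
      have t8: "tape n m8 w 0 (Suc i) (i + 3)" by (rule tape_cong[OF _ W7(2)]) (auto simp: m8_def)
      define m9 where "m9 = ev left (ev left (ev left m8))"
      note L = left3[OF c8 t8 i3, folded m9_def]
      have k8: "keeps m7 m8" by (auto simp: m8_def keeps_def)
      have k9: "keeps m6 m9" using W7(3) k8 L(3) keeps_trans by blast
      have r9: "outputs m9 hs" "m9 rG = int g"
        using outputs_keeps[OF k9] k9 r6 by (auto simp: keeps_def)
      have "stuck g w i"
        using False h1 unfolding stuck_def hop by auto
      from move[OF L(1,2) r9 this] have "greedy_inv w0 g w (Suc i) hs (ev right m9)" .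
      moreover have "m2 = ev right m9"
        unfolding m2 reject_def ev.simps run_simps(3) rewind m7_def[symmetric] forward m9_def[symmetric]
        using False V by simp
      ultimately have "greedy_inv w0 g w (Suc i) hs m2" by simp
      then show ?thesis by (rule fin) (use i in simp)
    qed
  qed
qed

section \<open>Initialisation and output\<close>

definition unit_vec :: "int \<Rightarrow> instr list" where
  "unit_vec off = init_vec 13 @ Const (rB 0) 0 # store_vec off 13"

text \<open>These are the costs of walks along the empty word, with \<open>rINF\<close> for
  unreachable states; they start both the suffix pass and the prefix pass.\<close>

lemma unit_vec:
  assumes "m rQ + off < -60"
  shows "s < 13 \<Longrightarrow> run (unit_vec off) m (m rQ + off - int s) = (if s = 0 then 0 else m rINF)"
    and "a \<notin> scratch \<Longrightarrow> a \<notin> {m rQ + off - 12..m rQ + off} \<Longrightarrow> run (unit_vec off) m a = m a"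
proof -
  define m1 where "m1 = (run (init_vec 13) m)(rB 0 := 0)"
  have e: "run (unit_vec off) m = run (store_vec off 13) m1" by (simp add: unit_vec_def m1_def)
  have fr: "m1 a = m a" if "a \<notin> scratch" for a
    using init_vec(3)[of 13 a m] that by (auto simp: m1_def scratch_def)
  have Q: "m1 rQ = m rQ" by (rule fr) (simp add: scratch_def)
  show "run (unit_vec off) m (m rQ + off - int s) = (if s = 0 then 0 else m rINF)" if "s < 13"
    using store_vec(1)[of 13 m1 off s] init_vec(1)[of 13 s m] Q assms that by (auto simp: e m1_def)
  show "run (unit_vec off) m a = m a" if "a \<notin> scratch" "a \<notin> {m rQ + off - 12..m rQ + off}"
    using store_vec(2)[of 13 m1 off a] Q assms that fr[OF that(1)] by (auto simp: e scratch_def)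
qed

definition prologue :: com where
  "prologue = Block [Const rT 1, Add rINF 0 rT, Const rT 0, Add rPOS 0 rT, Const rQ (-100)] ;;
     Block (unit_vec (-20))"

text \<open>The letter left of the cursor at position \<open>i\<close> is the input cell with
  address \<open>i\<close>, so \<open>rPOS\<close> itself serves as pointer. The letters are moved
  to the tape because the output will overwrite the input cells.\<close>

definition copy_body :: com where
  "copy_body = Block [Load rX rPOS, Const rT 40, Sub rT rQ rT, Store rT rX] ;; left"

text \<open>After the copying pass the cursor is at position 0, where the suffix cost from state 0
  is the cost of the whole word.\<close>

definition middle :: com where
  "middle = Block [Const rT (-20), Add rT rQ rT, Load rG rT] ;; Block (unit_vec (-1)) ;;
     Block [Const rT 2, Sub rC rREM rT]"

definition epilogue :: com where
  "epilogue = Block [Const rT 0, Add 0 rOUT rT]"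

definition copy_inv :: "bool list \<Rightarrow> nat \<Rightarrow> mem \<Rightarrow> bool" where
  "copy_inv w i m \<longleftrightarrow> i \<le> length w \<and> cursor (length w) m i \<and> tape (length w) m w i 0 i \<and>
     (\<forall>a \<ge> 0. m a = init_mem w a) \<and> m rOUT = 0"

lemma prologue_inv: "copy_inv w (length w) (ev prologue (init_mem w))"
proof -
  define n where "n = length w"
  define m1 where "m1 = (init_mem w)(rINF := int n + 1, rT := 0, rPOS := int n, rQ := -100)"
  have m1: "run [Const rT 1, Add rINF 0 rT, Const rT 0, Add rPOS 0 rT, Const rQ (-100)] (init_mem w) = m1"
    by (auto simp: m1_def fun_eq_iff init_mem_def n_def)
  define m2 where "m2 = run (unit_vec (-20)) m1"
  have e: "ev prologue (init_mem w) = m2" unfolding prologue_def ev.simps m1 m2_def ..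
  have Q: "m1 rQ = -100" "m1 rQ + -20 < -60" "rec_addr 0 = -100" by (simp_all add: m1_def rec_addr_def)
  note U = unit_vec[of m1 "-20", OF Q(2), folded m2_def, unfolded Q(1)]
  have fr: "m2 a = m1 a" if "-14 \<le> a" for a
    using that by (intro U(2)) (auto simp: scratch_def)
  have "cursor n m2 n"
    unfolding cursor_def by (simp add: fr Q) (simp add: m1_def init_mem_def)
  moreover have "suffix_ok n m2 w n"
    unfolding suffix_ok_def rep_def
  proof (intro allI impI)
    fix s K assume s: "s < (13::nat)" and K: "K \<le> int n"
    have "m2 (rec_addr (n - n) - 20 - int s) = (if s = 0 then 0 else int n + 1)"
      using U(1)[OF s] by (simp add: Q(3) m1_def)
    then show "m2 (rec_addr (n - n) - 20 - int s) \<le> K \<longleftrightarrow> (\<exists>c. walk s (drop n w) 0 c \<and> int c \<le> K)"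
      using K by (auto simp: n_def)
  qed
  then have "tape n m2 w n 0 n" by (auto simp: tape_def n_def)
  moreover have "\<forall>a \<ge> 0. m2 a = init_mem w a" by (auto simp: fr m1_def)
  moreover have "m2 rOUT = 0" by (simp add: fr m1_def init_mem_def)
  ultimately show ?thesis unfolding e copy_inv_def n_def by simp
qed

lemma copy_body_inv:
  assumes inv: "copy_inv w i m" and pos: "m rPOS > 0"
  shows "\<exists>i' < i. copy_inv w i' (ev copy_body m)"
proof -
  define n where "n = length w"
  have m: "i \<le> n" "cursor n m i" "tape n m w i 0 i" "\<forall>a \<ge> 0. m a = init_mem w a" "m rOUT = 0"
    using inv by (auto simp: copy_inv_def n_def)
  then obtain j where j: "i = Suc j" using pos by (cases i) (auto simp: cursor_def)
  have jn: "j < n" using m j by simp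
  have r: "m rQ - 40 = rec_addr (n - j)" using m(2) j rec_shift[OF jn] by (simp add: cursor_def)
  have b: "m rPOS = int (Suc j)" "m (int (Suc j)) = peg_bit (w ! j)"
    using m(2,4) j jn by (auto simp: cursor_def init_mem_def peg_bit_def n_def nat_add_distrib)
  define m1 where "m1 = m(rT := rec_addr (n - j), rX := peg_bit (w ! j), rec_addr (n - j) := peg_bit (w ! j))"
  have m1: "run [Load rX rPOS, Const rT 40, Sub rT rQ rT, Store rT rX] m = m1"
    using b r rec_bound[of "n - j"] by (auto simp: m1_def fun_eq_iff)
  have e: "ev copy_body m = ev left m1" unfolding copy_body_def ev.simps m1 ..
  have c1: "cursor n m1 (Suc j)"
    using m(2) j rec_bound[of "n - j"] by (auto simp: cursor_def m1_def)
  have "m1 (rec_addr (n - k)) = peg_bit (w ! k)" if "k < n" "j \<le> k" for k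
  proof (cases "k = j")
    case True
    then show ?thesis by (simp add: m1_def)
  next
    case False
    have "m (rec_addr (n - k)) = peg_bit (w ! k)" using m(3) that False j by (auto simp: tape_def)
    then show ?thesis using False that jn rec_bound[of "n - k"] by (auto simp: m1_def rec_eq_iff)
  qed
  moreover have "suffix_ok n m1 w k" if "k \<le> n" "Suc j \<le> k" for k
  proof (rule suffix_ok_cong)
    show "suffix_ok n m w k" using m(3) that j by (simp add: tape_def)
    show "m1 (rec_addr (n - k) - 20 - int s) = m (rec_addr (n - k) - 20 - int s)" if "s < 13" for s
      using rec_offset_eq[of "n - k" "20 + int s" "n - j"] that rec_bound[of "n - k"]
      by (auto simp: m1_def algebra_simps)
  qed simp
  ultimately have t1: "tape n m1 w j 0 (Suc j)" by (simp add: tape_def n_def)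
  note L = left_tape[OF c1 t1 jn order_refl]
  have "m1 a = m a" if "0 \<le> a \<or> a = rOUT" for a
    using that rec_bound[of "n - j"] by (auto simp: m1_def)
  then have "\<forall>a \<ge> 0. ev left m1 a = init_mem w a" "ev left m1 rOUT = 0"
    using L(3) m(4,5) by (auto simp: keeps_def)
  then have "copy_inv w j (ev copy_body m)"
    unfolding e copy_inv_def using L(1,2) jn by (simp add: n_def)
  then show ?thesis using j by blast
qed

lemma middle_inv:
  assumes inv: "copy_inv w i m" and pos: "\<not> m rPOS > 0"
  obtains g where "greedy_inv w g w 0 [] (ev middle m)" "ev middle m rC = int (length w) - 2"
    "g \<le> length w" "\<And>c. cost_le w c \<Longrightarrow> g \<le> c"
proof -
  define n where "n = length w"
  have i: "i = 0" using inv pos by (auto simp: copy_inv_def cursor_def)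
  have m: "cursor n m 0" "tape n m w 0 0 0" "m rOUT = 0"
    using inv i by (auto simp: copy_inv_def n_def)
  have Q: "m rQ = rec_addr n" "m rREM = int n" "m rINF = int n + 1" using m(1) by (auto simp: cursor_def)
  have "suffix_ok n m w 0" using m(2) by (simp add: tape_def)
  then have G: "rep n (m (rec_addr n - 20)) (walk 0 w 0)" by (auto simp: suffix_ok_def dest: spec[of _ 0])
  \<comment> \<open>The walk of single pegs shows that the stored value is a genuine cost and not
    the substitute for infinity.\<close>
  then have min: "m (rec_addr n - 20) \<le> int (pegs w)"
    using walk_singles[of w] pegs_le_length[of w] by (auto simp: rep_def n_def)
  have "0 \<le> m (rec_addr n - 20)" using G by (auto simp: rep_def dest!: spec[of _ "-1"])
  then obtain g where g: "m (rec_addr n - 20) = int g" using nonneg_int_cases by blast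
  have gn: "g \<le> n" using min g pegs_le_length[of w] by (simp add: n_def)
  have s: "cost_le w c \<longleftrightarrow> g \<le> c" if "c \<le> n" for c using rep_cost_le[OF G that] g by simp
  define m1 where "m1 = m(rT := rec_addr n - 20, rG := int g)"
  have m1: "run [Const rT (-20), Add rT rQ rT, Load rG rT] m = m1"
    using Q g rec_bound[of n] by (auto simp: m1_def fun_eq_iff)
  define m2 where "m2 = run (unit_vec (-1)) m1"
  define m3 where "m3 = m2(rC := m2 rREM - 2, rT := 2)"
  have e: "ev middle m = m3"
    unfolding middle_def ev.simps m1 m2_def[symmetric] m3_def by (auto simp: fun_eq_iff)
  have Q1: "m1 rQ = rec_addr n" "m1 rQ + -1 < -60" using Q rec_bound[of n] by (auto simp: m1_def)
  note U = unit_vec[of m1 "-1", OF Q1(2), folded m2_def, unfolded Q1(1)]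
  have fr: "m2 a = m1 a" if "-14 \<le> a" for a
    using that rec_bound[of n] by (intro U(2)) (auto simp: scratch_def)
  have c3: "cursor n m3 0"
    using Q unfolding cursor_def m3_def by (simp add: fr) (simp add: m1_def m(1)[unfolded cursor_def])
  have a3: "prefix_ok n m3 w 0"
    unfolding prefix_ok_def rep_def
  proof (intro allI impI)
    fix s K assume s: "s < (13::nat)" and K: "K \<le> int n"
    have "m3 (rec_addr (n - 0) - 1 - int s) = (if s = 0 then 0 else int n + 1)"
      using U(1)[OF s] Q rec_bound[of n] by (auto simp: m3_def m1_def)
    then show "m3 (rec_addr (n - 0) - 1 - int s) \<le> K \<longleftrightarrow> (\<exists>c. walk 0 (take 0 w) s c \<and> int c \<le> K)"
      using K by auto
  qed
  have off: "m3 (rec_addr r - x) = m (rec_addr r - x)" if "0 \<le> x" "x < 40" "x \<notin> {1..13}" for r x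
  proof -
    have "rec_addr r - x \<notin> {rec_addr n + -1 - 12..rec_addr n + -1}"
      using rec_offset_between[of r x n 13 1] that by auto
    then have "m2 (rec_addr r - x) = m1 (rec_addr r - x)"
      using that rec_bound[of r] by (intro U(2)) (auto simp: scratch_def)
    then show ?thesis using that rec_bound[of r] by (auto simp: m3_def m1_def)
  qed
  have "tape n m3 w 0 (Suc 0) 0"
    unfolding tape_def
  proof (intro conjI allI impI)
    show "m3 (rec_addr (n - k)) = peg_bit (w ! k)" if "k < n" for k
      using off[of 0 "n - k"] m(2) that by (simp add: tape_def)
    show "suffix_ok n m3 w k" if "k \<le> n" for k
    proof (rule suffix_ok_cong)
      show "suffix_ok n m w k" using m(2) that by (simp add: tape_def)
      show "m3 (rec_addr (n - k) - 20 - int s) = m (rec_addr (n - k) - 20 - int s)" if "s < 13" for s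
        using off[of "20 + int s" "n - k"] that by (simp add: algebra_simps)
    qed simp
  qed (use a3 in \<open>auto simp: n_def\<close>)
  moreover have "m3 rG = int g" "outputs m3 []" "m3 rC = int n - 2"
    using Q m(3) by (auto simp: m3_def fr outputs_def) (auto simp: m1_def)
  moreover have "cost_le w g" using s[OF gn] by simp
  ultimately have "greedy_inv w g w 0 [] (ev middle m)" "ev middle m rC = int (length w) - 2"
    unfolding e greedy_inv_def using c3 by (auto simp: n_def)
  moreover have "g \<le> c" if "cost_le w c" for c
  proof (cases "c \<le> n")
    case True
    then show ?thesis using s that by simp
  next
    case False
    then show ?thesis using gn by simp
  qed
  ultimately show thesis using that gn by (simp add: n_def)
qed

section \<open>Assembly of the program and its running time\<close>

definition program :: "instr list" where
  "program =
    (let p1 = clen prologue; p2 = p1 + clen copy_body + 3; p3 = p2 + clen middle;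
         p4 = p3 + clen body + 3
     in compile 0 prologue @ while_code p1 rPOS copy_body @ compile p2 middle @
        while_code p3 rC body @ compile p4 epilogue)"

lemma wf_seqs: "wf_com (seqs cs) \<longleftrightarrow> (\<forall>c \<in> set cs. wf_com c)"
  by (induction cs) auto

lemma list_all_concat_map: "list_all P (concat (map f xs)) \<longleftrightarrow> (\<forall>x \<in> set xs. list_all P (f x))"
  by (induction xs) auto

lemma wf_vstep: "wf_com (vstep off off' L0 L1)"
  by (auto simp: vstep_def load_vec_def init_vec_def store_vec_def list_all_concat_map wf_seqs relax_def
    simp del: upt_rec_numeral)

lemma wf_left: "wf_com left" and wf_right: "wf_com right"
  by (simp_all add: left_def right_def wf_vstep)

lemma wf_unit_vec: "list_all straight (unit_vec off)"
  by (auto simp: unit_vec_def init_vec_def store_vec_def list_all_concat_map simp del: upt_rec_numeral)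

lemma wf_dot: "wf_com dot"
  by (auto simp: dot_def wf_seqs dot_term_def simp del: upt_rec_numeral)

lemma wf_parts: "wf_com prologue" "wf_com copy_body" "wf_com middle" "wf_com body" "wf_com epilogue"
  by (simp_all add: prologue_def copy_body_def middle_def epilogue_def body_def try_hop_def accept_def
    reject_def back_up_def set_flag_def read3_def write3_def wf_left wf_right wf_unit_vec wf_dot)

lemma program_correct:
  fixes w :: "bool list"
  defines "T \<equiv> clen prologue + ((clen copy_body + 2) * length w + 2) + clen middle +
    ((clen body + 2) * (4 * length w) + 2) + clen epilogue"
  obtains m hs w' where "reaches program (0, init_mem w) T (length program, m)"
    "output_hops m hs" "hop_seq hs w w'" "\<And>v. reachable w v \<Longrightarrow> pegs w' \<le> pegs v"
proof -
  define n where "n = length w"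
  define c1 where "c1 = compile 0 prologue"
  define c2 where "c2 = while_code (length c1) rPOS copy_body"
  define c3 where "c3 = compile (length (c1 @ c2)) middle"
  define c4 where "c4 = while_code (length (c1 @ c2 @ c3)) rC body"
  define c5 where "c5 = compile (length (c1 @ c2 @ c3 @ c4)) epilogue"
  have len: "length c1 = clen prologue" "length c2 = clen copy_body + 3" "length c3 = clen middle"
    "length c4 = clen body + 3" "length c5 = clen epilogue"
    by (simp_all add: c1_def c2_def c3_def c4_def c5_def)
  have P: "program = c1 @ c2 @ c3 @ c4 @ c5"
    unfolding program_def Let_def c5_def c4_def c3_def c2_def c1_def by (simp add: add.assoc)
  let ?m1 = "ev prologue (init_mem w)"
  have r1: "reaches program (0, init_mem w) (clen prologue) (length c1, ?m1)"
    using reaches_compile[of program "[]" prologue "c2 @ c3 @ c4 @ c5"] wf_parts len P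
    by (simp add: c1_def)
  obtain i m2 where m2: "copy_inv w i m2" "\<not> m2 rPOS > 0" and
    "reaches program (length c1, ?m1) ((clen copy_body + 2) * length w + 2) (length c1 + clen copy_body + 3, m2)"
    using reaches_while[of program c1 rPOS copy_body "c3 @ c4 @ c5" "copy_inv w" "length w" ?m1]
      wf_parts prologue_inv copy_body_inv P unfolding c2_def by auto
  then have r2: "reaches program (length c1, ?m1) ((clen copy_body + 2) * length w + 2) (length (c1 @ c2), m2)"
    by (simp add: len add.assoc)
  obtain g where g: "greedy_inv w g w 0 [] (ev middle m2)" "ev middle m2 rC = int (length w) - 2"
    "g \<le> length w" and opt: "\<And>c. cost_le w c \<Longrightarrow> g \<le> c"
    using middle_inv[OF m2] by blast
  have r3: "reaches program (length (c1 @ c2), m2) (clen middle) (length (c1 @ c2 @ c3), ev middle m2)"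
    using reaches_compile[of program "c1 @ c2" middle "c4 @ c5" m2] wf_parts P len
    by (simp add: c3_def add.assoc)
  define I where "I k m \<longleftrightarrow> (\<exists>v i hs. greedy_inv w g v i hs m \<and> k = (n - i) + 3 * pegs v \<and>
    m rC = int n - int i - 2)" for k m
  have "I (n + 3 * pegs w) (ev middle m2)"
    unfolding I_def using g by (auto simp: n_def)
  moreover have "\<exists>k' < k. I k' (ev body m)" if Ik: "I k m" and C: "m rC > 0" for k m
  proof -
    obtain v i hs where inv: "greedy_inv w g v i hs m" "k = (n - i) + 3 * pegs v" "m rC = int n - int i - 2"
      using Ik by (auto simp: I_def)
    then have "i + 2 < length w" using C by (simp add: n_def)
    from body_greedy[OF inv(1) this g(3)] show ?thesis unfolding I_def inv(2) by (auto simp: n_def)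
  qed
  ultimately obtain k m4 where m4: "I k m4" "\<not> m4 rC > 0"
    and "reaches program (length (c1 @ c2 @ c3), ev middle m2) ((clen body + 2) * (n + 3 * pegs w) + 2)
      (length (c1 @ c2 @ c3) + clen body + 3, m4)"
    using reaches_while[of program "c1 @ c2 @ c3" rC body c5 I "n + 3 * pegs w" "ev middle m2"] wf_parts P
    unfolding c4_def by auto
  \<comment> \<open>The initial potential is at most \<open>4 * n\<close>, because there are at most
    \<open>n\<close> pegs.\<close>
  moreover have "(clen body + 2) * (n + 3 * pegs w) + 2 \<le> (clen body + 2) * (4 * length w) + 2"
    using pegs_le_length[of w] by (intro add_le_mono1 mult_le_mono2) (simp add: n_def)
  ultimately have r4: "reaches program (length (c1 @ c2 @ c3), ev middle m2)
      ((clen body + 2) * (4 * length w) + 2) (length (c1 @ c2 @ c3 @ c4), m4)"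
    using reaches_mono by (simp add: len add.assoc)
  have r5: "reaches program (length (c1 @ c2 @ c3 @ c4), m4) (clen epilogue) (length program, ev epilogue m4)"
  proof -
    have "length program = length (c1 @ c2 @ c3 @ c4) + clen epilogue" by (simp add: P len)
    then show ?thesis
      using reaches_compile[of program "c1 @ c2 @ c3 @ c4" epilogue "[]" m4] wf_parts(5) P
      by (simp only: c5_def append_assoc append_Nil2)
  qed
  obtain v i hs where inv: "greedy_inv w g v i hs m4" "m4 rC = int n - int i - 2"
    using m4(1) by (auto simp: I_def)
  have hs: "hop_seq hs w v" "outputs m4 hs" "cost_le v g" "\<forall>j<i. stuck g v j" "length v = length w"
    using inv(1) by (auto simp: greedy_inv_def Let_def tape_def)
  have "output_hops (ev epilogue m4) hs"
    using hs(2) by (auto simp: epilogue_def outputs_def output_hops_def hop_code_def peg_bit_def)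
  moreover have "pegs v \<le> pegs v'" if v': "reachable w v'" for v'
  proof -
    \<comment> \<open>The loop stops with \<open>i + 2 \<ge> n\<close>, so every window starts
      before the cursor and is stuck.\<close>
    have "pegs v \<le> g \<or> False \<notin> set v"
      using hs m4(2) inv(2) by (intro stuck_imp_optimal) (auto simp: n_def)
    then show ?thesis
    proof
      \<comment> \<open>Lower bound: the cost of \<open>w\<close> is at most that of the reachable
        \<open>v'\<close>, which is at most \<open>pegs v'\<close>.\<close>
      assume "pegs v \<le> g"
      also have "cost_le v' (pegs v')" using walk_singles by (auto simp: cost_le_def)
      then have "g \<le> pegs v'" by (intro opt reachable_cost_le[OF v'])
      finally show ?thesis .
    next
      assume "False \<notin> set v"
      then show ?thesis using no_hole_minimal[OF hop_seq_reachable[OF hs(1)] _ v'] by simp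
    qed
  qed
  ultimately show thesis
    using that reaches_trans[OF reaches_trans[OF reaches_trans[OF reaches_trans[OF r1 r2] r3] r4] r5] hs(1)
    unfolding T_def by blast
qed

theorem theorem2:
  shows "\<exists>(P :: instr list) (C :: nat). \<forall>w :: bool list.
           \<exists>t. t \<le> C * (length w + 1) \<and>
             halted P ((step P ^^ t) (0, init_mem w)) \<and>
             (\<exists>hs w'. output_hops (snd ((step P ^^ t) (0, init_mem w))) hs \<and>
                      hop_seq hs w w' \<and>
                      (\<forall>v. reachable w v \<longrightarrow> pegs w' \<le> pegs v))"
proof -
  \<comment> \<open>The 6 collects 2 extra steps per round of the copying loop and 2 for leaving
    each of the two loops.\<close>
  let ?C = "clen prologue + clen copy_body + clen middle + 4 * (clen body + 2) + clen epilogue + 6"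
  show ?thesis
  proof (rule exI[of _ program], rule exI[of _ ?C], rule allI)
    fix w :: "bool list"
    obtain m hs w' where r: "reaches program (0, init_mem w)
        (clen prologue + ((clen copy_body + 2) * length w + 2) + clen middle +
          ((clen body + 2) * (4 * length w) + 2) + clen epilogue) (length program, m)"
      and out: "output_hops m hs" "hop_seq hs w w'" "\<And>v. reachable w v \<Longrightarrow> pegs w' \<le> pegs v"
      using program_correct[of w] by blast
    have "clen prologue + ((clen copy_body + 2) * length w + 2) + clen middle +
          ((clen body + 2) * (4 * length w) + 2) + clen epilogue \<le> ?C * (length w + 1)"
      by (simp add: algebra_simps)
    with r obtain t where t: "t \<le> ?C * (length w + 1)"
      "(step program ^^ t) (0, init_mem w) = (length program, m)"
      unfolding reaches_def using le_trans by blast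
    have "halted program (length program, m)" by (simp add: halted_def fetch_def)
    with t out show "\<exists>t. t \<le> ?C * (length w + 1) \<and>
        halted program ((step program ^^ t) (0, init_mem w)) \<and>
        (\<exists>hs w'. output_hops (snd ((step program ^^ t) (0, init_mem w))) hs \<and>
          hop_seq hs w w' \<and> (\<forall>v. reachable w v \<longrightarrow> pegs w' \<le> pegs v))"
      by (intro exI[of _ t]) auto
  qed
qed

end
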